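(* Let $0\le\gamma<1$, let $\mathcal{H}$ be a complex Hilbert space, and let $f:\Omega_\gamma\to\mathcal{B}(\mathcal{H})$ be an analytic function with $\|f(z)\|\le1$ in $\Omega_\gamma$ such that $f(z)=\sum_{n=0}^\infty A_nz^n$ in $\mathbb{D}$, where $A_0=\alpha_0I$ with $|\alpha_0|<1$ and $A_n\in\mathcal{B}(\mathcal{H})$ for all $n\ge0$. Then for $\alpha>-1$, $$\mathcal{C}^\alpha_f(r)\le(\alpha+1)\sum_{n=0}^\infty\frac{r^n}{\alpha+n+1}=\frac{\alpha+1}{r^{\alpha+1}}\int_0^r\frac{t^\alpha}{1-t}\,dt$$ for $|z|=r\le R(\gamma,\alpha)$, where $R(\gamma,\alpha)$ is the smallest root in $(0,1)$ of $C_{\gamma,\alpha}(r)=0$ with $$C_{\gamma,\alpha}(r)=(3+\gamma)(1+\alpha)\sum_{n=0}^\infty\frac{r^n}{\alpha+n+1}-\frac{2}{1-r}.$$ The constant $R(\gamma,\alpha)$ cannot be improved further (for every $R'\in(R(\gamma,\alpha),1)$ there are a function $f$ satisfying the hypotheses and some $r\le R'$ for which the inequality fails).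
   Context: $\mathbb{D}=\{z\in\mathbb{C}:|z|<1\}$ and, for $0\le\gamma<1$, $\Omega_\gamma=\{z\in\mathbb{C}:|z+\frac{\gamma}{1-\gamma}|<\frac1{1-\gamma}\}$, a disk containing $\mathbb{D}$. $\mathcal{B}(\mathcal{H})$ is the space of bounded linear operators on $\mathcal{H}$ with the operator norm, and $I$ is the identity operator. For $\alpha>-1$, $C^\alpha_k=\frac{(\alpha+1)\cdots(\alpha+k)}{k!}$ (with $C^\alpha_0=1$), i.e. $(1-z)^{-(\alpha+1)}=\sum_{k\ge0}C^\alpha_kz^k$. For an analytic $f(z)=\sum_{n=0}^\infty A_nz^n$ on $\mathbb{D}$ with values in $\mathcal{B}(\mathcal{H})$, the Bohr sum of the $\alpha$-Cesàro operator is $$\mathcal{C}^\alpha_f(r)=\sum_{n=0}^\infty\Big(\frac{1}{C^{\alpha+1}_n}\sum_{k=0}^nC^\alpha_{k}\ast\|A\|\Big)_n r^n,\qquad\text{where } \Big(\frac{1}{C^{\alpha+1}_n}\sum_{k=0}^nC^\alpha_k\ast\|A\|\Big)_n:=\frac{1}{C^{\alpha+1}_n}\sum_{k=0}^nC^\alpha_{n-k}\|A_k\|.$$ *)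

theory Defs
  imports "HOL-Analysis.Analysis"
begin

class complex_vector = real_vector +
  fixes scaleC :: "complex \<Rightarrow> 'a \<Rightarrow> 'a"  (infixr \<open>*\<^sub>C\<close> 75)
  assumes scaleC_add_right: "a *\<^sub>C (x + y) = a *\<^sub>C x + a *\<^sub>C y"
    and scaleC_add_left: "(a + b) *\<^sub>C x = a *\<^sub>C x + b *\<^sub>C x"
    and scaleC_scaleC: "a *\<^sub>C b *\<^sub>C x = (a * b) *\<^sub>C x"
    and scaleR_scaleC: "r *\<^sub>R x = complex_of_real r *\<^sub>C x"

class complex_normed_vector = complex_vector + real_normed_vector +
  assumes norm_scaleC: "norm (a *\<^sub>C x) = cmod a * norm x"

text \<open>The inner product is linear in the first argument.  Completeness is with respect to
  the norm it induces, which is the norm of the underlying real normed space.\<close>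

class complex_hilbert_space = complex_normed_vector + banach +
  fixes cinner :: "'a \<Rightarrow> 'a \<Rightarrow> complex"
  assumes cinner_commute: "cinner x y = cnj (cinner y x)"
    and cinner_add_left: "cinner (x + y) z = cinner x z + cinner y z"
    and cinner_scaleC_left: "cinner (a *\<^sub>C x) y = a * cinner x y"
    and cinner_ge_zero: "0 \<le> Re (cinner x x)"
    and cinner_eq_zero_iff: "cinner x x = 0 \<longleftrightarrow> x = 0"
    and norm_eq_sqrt_cinner: "norm x = sqrt (Re (cinner x x))"

instantiation complex :: complex_hilbert_space
begin

definition scaleC_complex :: "complex \<Rightarrow> complex \<Rightarrow> complex"
  where "scaleC_complex a x = a * x"

definition cinner_complex :: "complex \<Rightarrow> complex \<Rightarrow> complex"
  where "cinner_complex x y = x * cnj y"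

instance
proof
  fix a b x y z :: complex and r :: real
  show "a *\<^sub>C (x + y) = a *\<^sub>C x + a *\<^sub>C y"
    by (simp add: scaleC_complex_def distrib_left)
  show "(a + b) *\<^sub>C x = a *\<^sub>C x + b *\<^sub>C x"
    by (simp add: scaleC_complex_def distrib_right)
  show "a *\<^sub>C b *\<^sub>C x = (a * b) *\<^sub>C x"
    by (simp add: scaleC_complex_def mult.assoc)
  show "r *\<^sub>R x = complex_of_real r *\<^sub>C x"
    by (simp add: scaleC_complex_def scaleR_conv_of_real)
  show "norm (a *\<^sub>C x) = cmod a * norm x"
    by (simp add: scaleC_complex_def norm_mult)
  show "cinner x y = cnj (cinner y x)"
    by (simp add: cinner_complex_def mult.commute)
  show "cinner (x + y) z = cinner x z + cinner y z"
    by (simp add: cinner_complex_def distrib_right)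
  show "cinner (a *\<^sub>C x) y = a * cinner x y"
    by (simp add: cinner_complex_def scaleC_complex_def mult.assoc)
  show "0 \<le> Re (cinner x x)"
    by (simp add: cinner_complex_def)
  show "cinner x x = 0 \<longleftrightarrow> x = 0"
    by (simp add: cinner_complex_def)
  show "norm x = sqrt (Re (cinner x x))"
    by (simp add: cinner_complex_def cmod_def power2_eq_square)
qed

end

lemma bounded_linear_scaleC: "bounded_linear ((*\<^sub>C) c :: 'a \<Rightarrow> 'a::complex_normed_vector)"
  by (rule bounded_linear_intro[where K = "cmod c"])
    (simp_all add: scaleC_add_right scaleR_scaleC scaleC_scaleC norm_scaleC mult.commute)

text \<open>The library type of bounded real-linear maps, normed by the operator norm, is a complex
  normed space under pointwise scalar multiplication as soon as the codomain is one.\<close>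

instantiation blinfun :: (real_normed_vector, complex_normed_vector) complex_normed_vector
begin

lift_definition scaleC_blinfun :: "complex \<Rightarrow> 'a \<Rightarrow>\<^sub>L 'b \<Rightarrow> 'a \<Rightarrow>\<^sub>L 'b"
  is "\<lambda>c T x. c *\<^sub>C T x"
  by (rule bounded_linear_compose[OF bounded_linear_scaleC])

instance
proof
  fix a b :: complex and r :: real and S T :: "'a \<Rightarrow>\<^sub>L 'b"
  show "a *\<^sub>C (S + T) = a *\<^sub>C S + a *\<^sub>C T"
    by transfer (simp add: scaleC_add_right)
  show "(a + b) *\<^sub>C S = a *\<^sub>C S + b *\<^sub>C S"
    by transfer (simp add: scaleC_add_left)
  show "a *\<^sub>C b *\<^sub>C S = (a * b) *\<^sub>C S"
    by transfer (simp add: scaleC_scaleC)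
  show "r *\<^sub>R S = complex_of_real r *\<^sub>C S"
    by transfer (simp add: scaleR_scaleC)
  have le: "norm (c *\<^sub>C U) \<le> cmod c * norm U" for c and U :: "'a \<Rightarrow>\<^sub>L 'b"
    by (rule norm_blinfun_bound)
      (simp_all add: scaleC_blinfun.rep_eq norm_scaleC mult.assoc mult_left_mono norm_blinfun)
  show "norm (a *\<^sub>C S) = cmod a * norm S"
  proof (cases "a = 0")
    case True
    then show ?thesis using le[of 0 S] by simp
  next
    case False
    have "inverse a *\<^sub>C a *\<^sub>C S = S"
      using False scaleR_scaleC[of 1, symmetric]
      by (intro blinfun_eqI) (simp add: scaleC_blinfun.rep_eq scaleC_scaleC)
    then have "norm S \<le> inverse (cmod a) * norm (a *\<^sub>C S)"
      using le[of "inverse a" "a *\<^sub>C S"] by (simp add: norm_inverse)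
    then have "cmod a * norm S \<le> norm (a *\<^sub>C S)"
      using False by (simp add: field_simps)
    with le[of a S] show ?thesis by simp
  qed
qed

end

text \<open>The space \<open>\<B>(\<H>)\<close>: the complex-linear maps among the bounded real-linear ones.\<close>

definition bounded_operators :: "('h::complex_hilbert_space \<Rightarrow>\<^sub>L 'h) set"
  where "bounded_operators = {T. \<forall>c x. blinfun_apply T (c *\<^sub>C x) = c *\<^sub>C blinfun_apply T x}"

definition vector_analytic_on :: "(complex \<Rightarrow> 'a::complex_normed_vector) \<Rightarrow> complex set \<Rightarrow> bool"
  where "vector_analytic_on f S \<longleftrightarrow>
    open S \<and> (\<forall>z\<in>S. \<exists>D. ((\<lambda>w. inverse (w - z) *\<^sub>C (f w - f z)) \<longlongrightarrow> D) (at z))"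

definition Omega :: "real \<Rightarrow> complex set"
  where "Omega \<gamma> = {z. cmod (z + complex_of_real (\<gamma> / (1 - \<gamma>))) < 1 / (1 - \<gamma>)}"

definition admissible ::
  "real \<Rightarrow> (complex \<Rightarrow> 'h::complex_hilbert_space \<Rightarrow>\<^sub>L 'h) \<Rightarrow> (nat \<Rightarrow> 'h \<Rightarrow>\<^sub>L 'h) \<Rightarrow> bool"
  where "admissible \<gamma> f A \<longleftrightarrow>
    (\<forall>z\<in>Omega \<gamma>. f z \<in> bounded_operators) \<and>
    vector_analytic_on f (Omega \<gamma>) \<and>
    (\<forall>z\<in>Omega \<gamma>. norm (f z) \<le> 1) \<and>
    (\<forall>n. A n \<in> bounded_operators) \<and>
    (\<forall>z. cmod z < 1 \<longrightarrow> (\<lambda>n. z ^ n *\<^sub>C A n) sums f z) \<and>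
    (\<exists>\<alpha>\<^sub>0. cmod \<alpha>\<^sub>0 < 1 \<and> A 0 = \<alpha>\<^sub>0 *\<^sub>C id_blinfun)"

definition cesaro_coeff :: "real \<Rightarrow> nat \<Rightarrow> real"
  where "cesaro_coeff \<alpha> k = (\<Prod>j=1..k. \<alpha> + real j) / fact k"

definition cesaro_bohr_term :: "real \<Rightarrow> (nat \<Rightarrow> 'a::real_normed_vector) \<Rightarrow> real \<Rightarrow> nat \<Rightarrow> real"
  where "cesaro_bohr_term \<alpha> A r n =
    (1 / cesaro_coeff (\<alpha> + 1) n * (\<Sum>k=0..n. cesaro_coeff \<alpha> (n - k) * norm (A k))) * r ^ n"

definition cesaro_bohr_sum :: "real \<Rightarrow> (nat \<Rightarrow> 'a::real_normed_vector) \<Rightarrow> real \<Rightarrow> real"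
  where "cesaro_bohr_sum \<alpha> A r = (\<Sum>n. cesaro_bohr_term \<alpha> A r n)"

definition cesaro_series :: "real \<Rightarrow> real \<Rightarrow> real"
  where "cesaro_series \<alpha> r = (\<Sum>n. r ^ n / (\<alpha> + real n + 1))"

lemma summable_cesaro_series:
  assumes "\<alpha> > -1" "\<bar>r\<bar> < 1"
  shows "summable (\<lambda>n. r ^ n / (\<alpha> + real n + 1))"
proof (rule summable_comparison_test')
  show "summable (\<lambda>n. \<bar>r\<bar> ^ n / (\<alpha> + 1))"
    using assms by (intro summable_divide summable_geometric) simp
  show "norm (r ^ n / (\<alpha> + real n + 1)) \<le> \<bar>r\<bar> ^ n / (\<alpha> + 1)" if "n \<ge> 0" for n
    using assms by (simp add: norm_divide power_abs frac_le)
qed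

definition cesaro_radius_fun :: "real \<Rightarrow> real \<Rightarrow> real \<Rightarrow> real"
  where "cesaro_radius_fun \<gamma> \<alpha> r = (3 + \<gamma>) * (1 + \<alpha>) * cesaro_series \<alpha> r - 2 / (1 - r)"

definition smallest_root_in_unit_interval :: "(real \<Rightarrow> real) \<Rightarrow> real \<Rightarrow> bool"
  where "smallest_root_in_unit_interval F R \<longleftrightarrow>
    0 < R \<and> R < 1 \<and> F R = 0 \<and> (\<forall>s. 0 < s \<and> s < 1 \<and> F s = 0 \<longrightarrow> R \<le> s)"

end

theory Submission
  imports Defs "HOL-Complex_Analysis.Complex_Analysis"
begin

text \<open>
  The theorem rests on the coefficient estimate
  \<open>norm (A n) \<le> (1 - \<bar>\<alpha>\<^sub>0\<bar>\<^sup>2) / (1 + \<gamma>)\<close> for \<open>n \<ge> 1\<close> (\<open>admissible_coeff_bound\<close>).  Granted this, the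
  Bohr sum is estimated row by row: the Cesaro weights in row \<open>n\<close> sum to 1, and the weight of
  \<open>A 0\<close> is \<open>(\<alpha> + 1) / (\<alpha> + n + 1)\<close>.  With \<open>S = (\<alpha> + 1) \<Sum> r\<^sup>n / (\<alpha> + n + 1)\<close> the Bohr sum is thus at most
  \<open>\<bar>\<alpha>\<^sub>0\<bar> S + (1 - \<bar>\<alpha>\<^sub>0\<bar>\<^sup>2) / (1 + \<gamma>) (1 / (1 - r) - S)\<close>, and since \<open>1 + \<bar>\<alpha>\<^sub>0\<bar> \<le> 2\<close> this is at most \<open>S\<close>
  as soon as \<open>2 (1 / (1 - r) - S) \<le> (1 + \<gamma>) S\<close>, that is, as soon as the radius function is nonnegative
  at \<open>r\<close>.

  For the coefficient estimate, the Moebius map \<open>\<zeta> \<mapsto> (1 + \<gamma>) \<zeta> / (1 + \<gamma> \<zeta>)\<close> from the unit disk onto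
  \<open>Omega \<gamma>\<close> fixes 0 and turns \<open>f\<close> into a contraction-valued \<open>F\<close> on the unit disk with
  \<open>F 0 = \<alpha>\<^sub>0 I\<close>.  There the Taylor coefficients beyond the zeroth have norm at most \<open>1 - \<bar>\<alpha>\<^sub>0\<bar>\<^sup>2\<close>,
  because the block matrix with rows \<open>(\<alpha>\<^sub>0, 0)\<close> and \<open>(F\<^sub>k, \<alpha>\<^sub>0)\<close> is a compression of multiplication by
  \<open>F\<close>, hence a contraction; testing it on one pair of vectors suffices.  Going back,
  \<open>f\<close> is \<open>F\<close> composed with the inverse \<open>b z = z / (1 + \<gamma> - \<gamma> z)\<close>.  The powers of \<open>b\<close> have
  nonnegative Taylor coefficients, so the constant bound is transported with the factor
  \<open>\<Sum>\<^sub>i [z\<^sup>n] b\<^sup>i = 1 / (1 + \<gamma>)\<close>.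

  The function \<open>(1 - r) \<Sum> r\<^sup>n / (\<alpha> + n + 1)\<close> decreases strictly on \<open>[0, 1)\<close> and tends to 0 at 1, so the
  radius function has exactly one root \<open>R\<close> and is negative beyond it.  Negativity at a point \<open>r\<close>
  is what makes the inequality fail there: for \<open>f z = \<phi>\<^sub>a (\<gamma> + (1 - \<gamma>) z) I\<close> with the disk
  automorphism \<open>\<phi>\<^sub>a w = (a - w) / (1 - a w)\<close> the quotient of \<open>norm (A n)\<close>, \<open>n \<ge> 1\<close>, by
  \<open>1 - norm (A 0)\<close> tends to \<open>2 / (1 + \<gamma>)\<close> as \<open>a\<close> increases to 1.  Hence for \<open>a\<close> near 1 the coefficients
  beyond the zeroth contribute more than \<open>(1 - norm (A 0)) S\<close>, already within finitely many rows.
  The integral formula holds because \<open>t\<^bsup>\<alpha>+1\<^esup> \<Sum> t\<^sup>n / (\<alpha> + n + 1)\<close> is an antiderivative of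
  \<open>t\<^sup>\<alpha> / (1 - t)\<close>.
\<close>

section \<open>Inner products and operator norms\<close>

lemma cinner_add_right:
  fixes x y z :: "'h::complex_hilbert_space"
  shows "cinner x (y + z) = cinner x y + cinner x z"
  by (metis cinner_commute cinner_add_left complex_cnj_add)

lemma cinner_scaleC_right:
  fixes x y :: "'h::complex_hilbert_space"
  shows "cinner x (c *\<^sub>C y) = cnj c * cinner x y"
  by (metis cinner_commute cinner_scaleC_left complex_cnj_mult)

lemma power2_norm_eq_cinner:
  fixes x :: "'h::complex_hilbert_space"
  shows "(norm x)\<^sup>2 = Re (cinner x x)"
  by (simp add: norm_eq_sqrt_cinner cinner_ge_zero)

lemma cinner_self:
  fixes x :: "'h::complex_hilbert_space"
  shows "cinner x x = complex_of_real ((norm x)\<^sup>2)"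
proof -
  have "Im (cinner x x) = 0"
    using cinner_commute[of x x] by (simp add: complex_eq_iff)
  then show ?thesis
    by (simp add: complex_eq_iff power2_norm_eq_cinner)
qed

lemma power2_norm_add:
  fixes x y :: "'h::complex_hilbert_space"
  shows "(norm (x + y))\<^sup>2 = (norm x)\<^sup>2 + (norm y)\<^sup>2 + 2 * Re (cinner x y)"
proof -
  have "Re (cinner y x) = Re (cinner x y)"
    by (subst cinner_commute) simp
  then show ?thesis
    by (simp add: power2_norm_eq_cinner cinner_add_left cinner_add_right)
qed

text \<open>This is \<open>\<parallel>x - y\<parallel>\<^sup>2 \<ge> 0\<close>; unlike the Cauchy-Schwarz inequality it is additive, so it can be
  averaged over a circle term by term.\<close>
lemma Re_cinner_le:
  fixes x y :: "'h::complex_hilbert_space"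
  shows "2 * Re (cinner x y) \<le> (norm x)\<^sup>2 + (norm y)\<^sup>2"
proof -
  have "0 \<le> (norm (x + (-1) *\<^sub>C y))\<^sup>2" by simp
  also have "\<dots> = (norm x)\<^sup>2 + (norm y)\<^sup>2 - 2 * Re (cinner x y)"
    unfolding power2_norm_add by (simp add: norm_scaleC cinner_scaleC_right)
  finally show ?thesis by simp
qed

lemma cmod_cinner_le:
  fixes x y :: "'h::complex_hilbert_space"
  shows "cmod (cinner x y) \<le> norm x * norm y"
proof (cases "x = 0 \<or> y = 0 \<or> cinner x y = 0")
  case True
  have "cinner 0 v = 0" "cinner v 0 = 0" for v :: 'h
    using cinner_add_left[of 0 0 v] cinner_add_right[of v 0 0] by simp_all
  with True show ?thesis by auto
next
  case False
  \<comment> \<open>Normalise both vectors and rotate \<open>x\<close> so that the inner product becomes positive.\<close>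
  define s where "s = cnj (cinner x y) / (cmod (cinner x y) * norm x)"
  define x' where "x' = s *\<^sub>C x"
  define y' where "y' = complex_of_real (inverse (norm y)) *\<^sub>C y"
  have "norm x' = 1" "norm y' = 1"
    using False by (simp_all add: x'_def y'_def s_def norm_scaleC norm_divide norm_inverse norm_mult)
  then have "Re (cinner x' y') \<le> 1"
    using Re_cinner_le[of x' y'] by simp
  moreover have "cinner x' y' =
      (cinner x y * cnj (cinner x y)) / of_real (cmod (cinner x y) * norm x * norm y)"
    by (simp add: x'_def y'_def s_def cinner_scaleC_left cinner_scaleC_right field_simps)
  then have "cinner x' y' = of_real (cmod (cinner x y) / (norm x * norm y))"
    using False by (simp add: complex_norm_square[symmetric] power2_eq_square)
  ultimately show ?thesis
    using False by (simp add: field_simps)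
qed

lemma bounded_linear_cinner_apply:
  fixes x y :: "'h::complex_hilbert_space"
  shows "bounded_linear (\<lambda>T. cinner (blinfun_apply T x) y)"
proof (rule bounded_linear_intro[where K = "norm x * norm y"])
  fix S T :: "'h \<Rightarrow>\<^sub>L 'h" and r :: real
  show "cinner (blinfun_apply (S + T) x) y =
      cinner (blinfun_apply S x) y + cinner (blinfun_apply T x) y"
    by (simp add: blinfun.add_left cinner_add_left)
  show "cinner (blinfun_apply (r *\<^sub>R T) x) y = r *\<^sub>R cinner (blinfun_apply T x) y"
    by (simp add: blinfun.scaleR_left scaleR_scaleC[where 'a = 'h] cinner_scaleC_left
        scaleR_conv_of_real)
  have "cmod (cinner (blinfun_apply T x) y) \<le> norm (blinfun_apply T x) * norm y"
    by (rule cmod_cinner_le)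
  also have "\<dots> \<le> norm T * norm x * norm y"
    by (intro mult_right_mono norm_blinfun) auto
  finally show "norm (cinner (blinfun_apply T x) y) \<le> norm T * (norm x * norm y)"
    by (simp add: mult.assoc)
qed

text \<open>Only real parts have to be bounded, since \<open>y\<close> may be taken in the direction of \<open>T u\<close>.\<close>
lemma norm_blinfun_le_if_Re_cinner_le:
  fixes T :: "'h::complex_hilbert_space \<Rightarrow>\<^sub>L 'h"
  assumes "0 \<le> M"
    and le: "\<And>u y. norm u = 1 \<Longrightarrow> norm y = 1 \<Longrightarrow> Re (cinner (blinfun_apply T u) y) \<le> M"
  shows "norm T \<le> M"
proof (rule norm_blinfun_bound[OF \<open>0 \<le> M\<close>])
  fix x
  show "norm (blinfun_apply T x) \<le> M * norm x"
  proof (cases "blinfun_apply T x = 0")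
    case True
    with \<open>0 \<le> M\<close> show ?thesis by simp
  next
    case False
    then have x: "x \<noteq> 0" by auto
    define u where "u = inverse (norm x) *\<^sub>R x"
    define y where "y = inverse (norm (blinfun_apply T x)) *\<^sub>R blinfun_apply T x"
    have "Re (cinner (blinfun_apply T u) y) \<le> M"
      using x False by (intro le) (simp_all add: u_def y_def)
    moreover have "blinfun_apply T u = inverse (norm x) *\<^sub>R blinfun_apply T x"
      by (simp add: u_def blinfun.scaleR_right)
    then have "cinner (blinfun_apply T u) y = of_real (norm (blinfun_apply T x) / norm x)"
      using x False
      by (simp add: y_def scaleR_scaleC cinner_scaleC_left
          cinner_scaleC_right cinner_self power2_eq_square field_simps)
    ultimately show ?thesis
      using x by (simp add: field_simps)
  qed
qed

lemma bounded_linear_scaleC_left: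
  fixes T :: "'a::complex_normed_vector"
  shows "bounded_linear (\<lambda>c. c *\<^sub>C T)"
  by (rule bounded_linear_intro[where K = "norm T"])
    (simp_all add: scaleC_add_left norm_scaleC scaleR_scaleC[where 'a = 'a] scaleC_scaleC
      scaleR_conv_of_real)

lemma norm_id_blinfun_le: "norm (id_blinfun :: 'a::real_normed_vector \<Rightarrow>\<^sub>L 'a) \<le> 1"
  by (rule norm_blinfun_bound) auto

section \<open>Coefficients of contractive functions on the unit disk\<close>

text \<open>Matrix coefficients reduce the analysis of operator-valued functions to scalar complex analysis.\<close>
lemma holomorphic_on_cinner_apply:
  fixes f :: "complex \<Rightarrow> 'h::complex_hilbert_space \<Rightarrow>\<^sub>L 'h"
  assumes "vector_analytic_on f S"
  shows "(\<lambda>z. cinner (blinfun_apply (f z) x) y) holomorphic_on S"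
proof -
  interpret L: bounded_linear "\<lambda>T. cinner (blinfun_apply T x) y"
    by (rule bounded_linear_cinner_apply)
  have S: "open S" using assms by (simp add: vector_analytic_on_def)
  have "\<exists>D. ((\<lambda>z. cinner (blinfun_apply (f z) x) y) has_field_derivative D) (at z)"
    if z: "z \<in> S" for z
  proof -
    obtain D where "((\<lambda>w. inverse (w - z) *\<^sub>C (f w - f z)) \<longlongrightarrow> D) (at z)"
      using assms z by (auto simp: vector_analytic_on_def)
    from L.tendsto[OF this]
    have "((\<lambda>w. (cinner (blinfun_apply (f w) x) y - cinner (blinfun_apply (f z) x) y) / (w - z))
        \<longlongrightarrow> cinner (blinfun_apply D x) y) (at z)"
      by (simp add: scaleC_blinfun.rep_eq cinner_scaleC_left L.diff[symmetric]
          divide_inverse mult.commute)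
    then show ?thesis
      by (auto simp: has_field_derivative_iff)
  qed
  then show ?thesis
    using S by (auto simp: holomorphic_on_open)
qed

text \<open>The \<open>k\<close>-th coefficient is the mean of \<open>H z / z\<^sup>k\<close> over the circle of radius \<open>\<rho>\<close>, by the
  Cauchy formula, and a mean preserves upper bounds of the real part.\<close>
lemma Re_fps_nth_le_if_Re_rotated_le:
  fixes H :: "complex \<Rightarrow> complex"
  assumes holo: "H holomorphic_on ball 0 1" and fps: "H has_fps_expansion P"
    and \<rho>: "0 < \<rho>" "\<rho> < 1"
    and le: "\<And>z. cmod z = \<rho> \<Longrightarrow> Re (H z * of_real (\<rho> ^ k) / z ^ k) \<le> M"
  shows "\<rho> ^ k * Re (fps_nth P k) \<le> M"
proof -
  have sub: "cball 0 \<rho> \<subseteq> ball (0::complex) 1" using \<rho> by auto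
  define c where "c = circlepath 0 \<rho>"
  have "((\<lambda>u. H u / (u - 0) ^ Suc k) has_contour_integral (2 * pi * \<i>) / fact k * (deriv ^^ k) H 0) c"
    unfolding c_def
  proof (rule Cauchy_has_contour_integral_higher_derivative_circlepath)
    show "continuous_on (cball 0 \<rho>) H"
      using holo sub by (blast intro: holomorphic_on_imp_continuous_on holomorphic_on_subset)
    show "H holomorphic_on ball 0 \<rho>"
      using \<rho> by (intro holomorphic_on_subset[OF holo]) auto
  qed (use \<rho> in auto)
  then have "((\<lambda>t. H (c t) / c t ^ Suc k * vector_derivative c (at t)) has_integral
      2 * pi * \<i> * fps_nth P k) {0..1}"
    by (simp add: has_contour_integral c_def fps_nth_fps_expansion[OF fps])
  moreover have "H (c t) / c t ^ Suc k * vector_derivative c (at t) = 2 * pi * \<i> * (H (c t) / c t ^ k)" for t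
  proof -
    have "vector_derivative c (at t) = 2 * pi * \<i> * c t"
      unfolding c_def vector_derivative_circlepath by (simp add: circlepath)
    moreover have "c t \<noteq> 0"
      using \<rho> by (simp add: c_def circlepath)
    ultimately show ?thesis by simp
  qed
  ultimately have "((\<lambda>t. 2 * pi * \<i> * (H (c t) / c t ^ k)) has_integral 2 * pi * \<i> * fps_nth P k) {0..1}"
    by simp
  from has_integral_mult_right[OF this, of "of_real (\<rho> ^ k) / (2 * pi * \<i>)"]
  have "((\<lambda>t. H (c t) * of_real (\<rho> ^ k) / c t ^ k) has_integral of_real (\<rho> ^ k) * fps_nth P k) {0..1}"
    by (simp add: field_simps)
  from has_integral_linear[OF this bounded_linear_Re]
  have "((\<lambda>t. Re (H (c t) * of_real (\<rho> ^ k) / c t ^ k)) has_integral \<rho> ^ k * Re (fps_nth P k)) {0..1}"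
    by (simp add: o_def flip: of_real_power)
  moreover have "((\<lambda>t. M) has_integral M) {0..1::real}"
    using has_integral_const_real[of M 0 1] by simp
  moreover have "Re (H (c t) * of_real (\<rho> ^ k) / c t ^ k) \<le> M" for t
    using \<rho> by (intro le) (simp add: c_def circlepath norm_mult)
  ultimately show ?thesis
    by (rule has_integral_le)
qed

text \<open>The block matrix with rows \<open>(\<alpha>\<^sub>0, 0)\<close> and \<open>(F\<^sub>k, \<alpha>\<^sub>0)\<close> is a contraction.  It is tested on the input
  \<open>(u, c y)\<close> with \<open>c = cnj \<alpha>\<^sub>0\<close> against the output \<open>(\<alpha>\<^sub>0 u, y)\<close>, the pair for which equality holds
  when \<open>F\<^sub>k u = (1 - \<bar>\<alpha>\<^sub>0\<bar>\<^sup>2) y\<close>.  To avoid vector-valued Hardy spaces, the pairing is written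
  pointwise as \<open>\<langle>F z (u + e c y), \<alpha>\<^sub>0 u + e y\<rangle>\<close> with the phase \<open>e = (z / \<rho>)\<^sup>k\<close>, estimated by
  \<open>Re_cinner_le\<close>, and averaged over the circle.\<close>
lemma Re_coeff_le_of_contractive:
  fixes F :: "complex \<Rightarrow> 'h::complex_hilbert_space \<Rightarrow>\<^sub>L 'h"
  assumes holo: "\<And>x y. (\<lambda>z. cinner (blinfun_apply (F z) x) y) holomorphic_on ball 0 1"
    and lin: "\<And>z. cmod z < 1 \<Longrightarrow> F z \<in> bounded_operators"
    and contr: "\<And>z. cmod z < 1 \<Longrightarrow> norm (F z) \<le> 1"
    and F0: "F 0 = \<alpha>\<^sub>0 *\<^sub>C id_blinfun"
    and P: "(\<lambda>z. cinner (blinfun_apply (F z) u) y) has_fps_expansion P"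
    and unit: "norm u = 1" "norm y = 1" and k: "1 \<le> k"
  shows "Re (fps_nth P k) \<le> 1 - (cmod \<alpha>\<^sub>0)\<^sup>2"
proof -
  define c where "c = cnj \<alpha>\<^sub>0"
  have cmod_c: "c * \<alpha>\<^sub>0 = of_real ((cmod \<alpha>\<^sub>0)\<^sup>2)"
    by (simp add: c_def complex_norm_square mult.commute del: of_real_power)
  define \<phi> where "\<phi> x y z = cinner (blinfun_apply (F z) x) y" for x y z
  have fps: "\<phi> v w has_fps_expansion fps_expansion (\<phi> v w) 0" for v w
    unfolding \<phi>_def using holo[of v w] by (intro has_fps_expansion_fps_expansion[of "ball 0 1"]) auto
  have coeff0: "fps_nth (fps_expansion (\<phi> v w) 0) 0 = \<alpha>\<^sub>0 * cinner v w" for v w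
    by (simp add: fps_expansion_def \<phi>_def F0 scaleC_blinfun.rep_eq cinner_scaleC_left)
  \<comment> \<open>The two squared norms have cross terms in \<open>cinner u y\<close>, which oscillate like \<open>cnj e\<close> and so
    have mean zero.  Together they are the real part of \<open>cnj e * \<kappa>\<close>.\<close>
  define \<kappa> where "\<kappa> = 2 * \<alpha>\<^sub>0 * cinner u y"

  have pointwise: "Re (c * (\<phi> u u z + \<phi> y y z) + cnj e * (\<phi> u y z - \<kappa>) + c\<^sup>2 * e * \<phi> y u z) \<le> 1 + (cmod \<alpha>\<^sub>0)\<^sup>2"
    if z: "cmod z < 1" and e: "cmod e = 1" for z e
  proof -
    have ee: "e * cnj e = 1"
      using e by (simp add: complex_norm_square[symmetric])
    define h where "h = u + (e * c) *\<^sub>C y"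
    define g where "g = \<alpha>\<^sub>0 *\<^sub>C u + e *\<^sub>C y"
    have Fh: "blinfun_apply (F z) h = blinfun_apply (F z) u + (e * c) *\<^sub>C blinfun_apply (F z) y"
      using lin[OF z] by (simp add: h_def blinfun.add_right bounded_operators_def)
    have "cinner (blinfun_apply (F z) h) g =
        c * \<phi> u u z + cnj e * \<phi> u y z + e * c * c * \<phi> y u z + (e * cnj e) * c * \<phi> y y z"
      by (simp add: Fh g_def \<phi>_def c_def cinner_add_left cinner_add_right cinner_scaleC_left
          cinner_scaleC_right algebra_simps)
    then have prod: "cinner (blinfun_apply (F z) h) g =
        c * (\<phi> u u z + \<phi> y y z) + cnj e * \<phi> u y z + c\<^sup>2 * e * \<phi> y u z"
      by (simp add: ee power2_eq_square algebra_simps)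
    have "norm (blinfun_apply (F z) h) \<le> norm (F z) * norm h" by (rule norm_blinfun)
    also have "\<dots> \<le> 1 * norm h" using contr[OF z] by (intro mult_right_mono) auto
    finally have "(norm (blinfun_apply (F z) h))\<^sup>2 \<le> (norm h)\<^sup>2" by (simp add: power_mono)
    with Re_cinner_le[of "blinfun_apply (F z) h" g]
    have "2 * Re (cinner (blinfun_apply (F z) h) g) \<le> (norm h)\<^sup>2 + (norm g)\<^sup>2" by linarith
    moreover have "(norm h)\<^sup>2 = 1 + (cmod \<alpha>\<^sub>0)\<^sup>2 + Re (cnj e * \<kappa>)"
      unfolding h_def power2_norm_add
      by (simp add: norm_scaleC unit norm_mult e c_def cinner_scaleC_right \<kappa>_def algebra_simps)
    moreover have "(norm g)\<^sup>2 = (cmod \<alpha>\<^sub>0)\<^sup>2 + 1 + Re (cnj e * \<kappa>)"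
      unfolding g_def power2_norm_add
      by (simp add: norm_scaleC unit e cinner_scaleC_right cinner_scaleC_left \<kappa>_def algebra_simps)
    ultimately show ?thesis
      unfolding prod by (simp add: algebra_simps)
  qed

  have bound: "2 * (cmod \<alpha>\<^sub>0)\<^sup>2 + \<rho> ^ k * Re (fps_nth P k) \<le> 1 + (cmod \<alpha>\<^sub>0)\<^sup>2"
    if \<rho>: "0 < \<rho>" "\<rho> < 1" for \<rho>
  proof -
    \<comment> \<open>On the circle of radius \<open>\<rho>\<close>, where \<open>cnj e = \<rho>\<^sup>k / z\<^sup>k\<close>, the quantity bounded above is
      \<open>\<rho>\<^sup>k H z / z\<^sup>k\<close> for the holomorphic function \<open>H\<close> below.\<close>
    define s where "s = complex_of_real (1 / \<rho> ^ k)"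
    define H where "H z = s * c * (\<phi> u u z + \<phi> y y z) * z ^ k + (\<phi> u y z - \<kappa>) +
      s\<^sup>2 * c\<^sup>2 * \<phi> y u z * (z ^ k * z ^ k)" for z
    define Q where "Q = fps_const (s * c) * (fps_expansion (\<phi> u u) 0 + fps_expansion (\<phi> y y) 0) * fps_X ^ k +
      (P - fps_const \<kappa>) + fps_const (s\<^sup>2 * c\<^sup>2) * fps_expansion (\<phi> y u) 0 * (fps_X ^ k * fps_X ^ k)"
    have "H holomorphic_on ball 0 1"
      unfolding H_def \<phi>_def by (intro holomorphic_intros holo)
    moreover have "H has_fps_expansion Q"
      unfolding H_def Q_def using P
      by (intro fps_expansion_intros fps) (simp_all add: \<phi>_def)
    moreover have "Re (H z * of_real (\<rho> ^ k) / z ^ k) \<le> 1 + (cmod \<alpha>\<^sub>0)\<^sup>2" if z: "cmod z = \<rho>" for z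
    proof -
      define e where "e = z ^ k / of_real (\<rho> ^ k)"
      have e: "cmod e = 1" using z \<rho> by (simp add: e_def norm_divide norm_power)
      have nz: "e \<noteq> 0" using e by auto
      then have inv: "1 / e = cnj e"
        using e complex_norm_square[of e] by (simp add: field_simps)
      have zk: "z ^ k = e * of_real (\<rho> ^ k)" using \<rho> by (simp add: e_def)
      have Hz: "H z = c * (\<phi> u u z + \<phi> y y z) * e + (\<phi> u y z - \<kappa>) + c\<^sup>2 * \<phi> y u z * (e * e)"
        using \<rho> by (simp add: H_def zk s_def power2_eq_square field_simps)
      have "H z * of_real (\<rho> ^ k) / z ^ k = H z * (1 / e)"
        using \<rho> nz by (simp add: zk)
      also have "\<dots> = c * (\<phi> u u z + \<phi> y y z) + (1 / e) * (\<phi> u y z - \<kappa>) + c\<^sup>2 * e * \<phi> y u z"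
        unfolding Hz using nz by (simp add: field_simps)
      finally have "H z * of_real (\<rho> ^ k) / z ^ k =
          c * (\<phi> u u z + \<phi> y y z) + cnj e * (\<phi> u y z - \<kappa>) + c\<^sup>2 * e * \<phi> y u z"
        by (simp only: inv)
      then show ?thesis
        using pointwise[OF _ e, of z] z \<rho> by (simp only:)
    qed
    ultimately have "\<rho> ^ k * Re (fps_nth Q k) \<le> 1 + (cmod \<alpha>\<^sub>0)\<^sup>2"
      using \<rho> by (intro Re_fps_nth_le_if_Re_rotated_le)
    moreover have "fps_nth Q k = s * c * (2 * \<alpha>\<^sub>0) + fps_nth P k"
      using k by (simp add: Q_def fps_X_power_mult_right_nth coeff0 cinner_self unit
          power_add[symmetric])
    then have "\<rho> ^ k * Re (fps_nth Q k) = 2 * (cmod \<alpha>\<^sub>0)\<^sup>2 + \<rho> ^ k * Re (fps_nth P k)"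
    proof -
      assume eq: "fps_nth Q k = s * c * (2 * \<alpha>\<^sub>0) + fps_nth P k"
      have "s * c * (2 * \<alpha>\<^sub>0) = of_real (2 * (cmod \<alpha>\<^sub>0)\<^sup>2 / \<rho> ^ k)"
        using cmod_c by (simp add: s_def algebra_simps)
      then show ?thesis unfolding eq using \<rho>
        by (simp add: algebra_simps del: of_real_divide of_real_mult of_real_power)
    qed
    ultimately show ?thesis by simp
  qed
  have "((\<lambda>\<rho>. 2 * (cmod \<alpha>\<^sub>0)\<^sup>2 + \<rho> ^ k * Re (fps_nth P k)) \<longlongrightarrow>
      2 * (cmod \<alpha>\<^sub>0)\<^sup>2 + 1 ^ k * Re (fps_nth P k)) (at_left 1)"
    by (intro tendsto_intros)
  moreover have "eventually (\<lambda>\<rho>. 2 * (cmod \<alpha>\<^sub>0)\<^sup>2 + \<rho> ^ k * Re (fps_nth P k) \<le> 1 + (cmod \<alpha>\<^sub>0)\<^sup>2)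
      (at_left (1::real))"
    using bound by (intro eventually_at_leftI[of 0]) auto
  ultimately have "2 * (cmod \<alpha>\<^sub>0)\<^sup>2 + 1 ^ k * Re (fps_nth P k) \<le> 1 + (cmod \<alpha>\<^sub>0)\<^sup>2"
    by (intro tendsto_upperbound) auto
  then show ?thesis by simp
qed

section \<open>The larger disk\<close>

text \<open>The difference of the squares is \<open>(1 - t\<^sup>2) (1 - \<bar>w\<bar>\<^sup>2)\<close>.  This makes both the map
  \<open>w \<mapsto> (t + w) / (1 + t w)\<close> and, with \<open>-w\<close> in place of \<open>w\<close>, the extremal functions self-maps of the
  unit disk.\<close>
lemma cmod_real_add_less:
  assumes "0 \<le> t" "t < 1" "cmod w < 1"
  shows "cmod (of_real t + w) < cmod (1 + of_real t * w)"
proof (rule power2_less_imp_less)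
  have "0 < (1 - t\<^sup>2) * (1 - (cmod w)\<^sup>2)"
    using assms by (intro mult_pos_pos) (auto simp: abs_square_less_1)
  also have "\<dots> = (cmod (1 + of_real t * w))\<^sup>2 - (cmod (of_real t + w))\<^sup>2"
    unfolding cmod_power2 by (simp add: power2_eq_square algebra_simps)
  finally show "(cmod (of_real t + w))\<^sup>2 < (cmod (1 + of_real t * w))\<^sup>2" by simp
qed simp

lemma Omega_iff:
  assumes "\<gamma> < 1"
  shows "z \<in> Omega \<gamma> \<longleftrightarrow> cmod (of_real \<gamma> + of_real (1 - \<gamma>) * z) < 1"
proof -
  have "of_real \<gamma> + of_real (1 - \<gamma>) * z = of_real (1 - \<gamma>) * (z + of_real (\<gamma> / (1 - \<gamma>)))"
    using assms by (simp add: field_simps flip: of_real_diff)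
  then have "cmod (of_real \<gamma> + of_real (1 - \<gamma>) * z) = (1 - \<gamma>) * cmod (z + of_real (\<gamma> / (1 - \<gamma>)))"
    using assms by (simp add: norm_mult del: of_real_diff)
  then show ?thesis
    using assms unfolding Omega_def mem_Collect_eq
    by (simp only:) (simp add: pos_less_divide_eq mult.commute)
qed

lemma open_Omega: "open (Omega \<gamma>)"
  unfolding Omega_def by (intro open_Collect_less continuous_intros)

text \<open>The Taylor series at 0 of \<open>b z = z / (1 + \<gamma> - \<gamma> z)\<close>, the inverse of the Moebius map from the unit
  disk onto \<open>Omega \<gamma>\<close>.\<close>
definition disk_change_fps :: "real \<Rightarrow> complex fps"
  where "disk_change_fps \<gamma> = Abs_fps (\<lambda>n. if n = 0 then 0 else of_real (\<gamma> ^ (n - 1) / (1 + \<gamma>) ^ n))"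

lemma disk_change_has_fps_expansion:
  assumes "0 \<le> \<gamma>"
  shows "(\<lambda>z. z / (of_real (1 + \<gamma>) - of_real \<gamma> * z)) has_fps_expansion disk_change_fps \<gamma>"
proof (rule has_fps_expansionI)
  have "(\<lambda>n. fps_nth (disk_change_fps \<gamma>) n * z ^ n) sums (z / (of_real (1 + \<gamma>) - of_real \<gamma> * z))"
    if z: "cmod z < 1" for z
  proof -
    define q where "q = of_real (\<gamma> / (1 + \<gamma>)) * z"
    have "cmod q = \<gamma> / (1 + \<gamma>) * cmod z"
      using assms unfolding q_def norm_mult norm_of_real by simp
    also have "\<dots> \<le> \<gamma> / (1 + \<gamma>) * 1" using z assms by (intro mult_left_mono) auto
    also have "\<dots> < 1" using assms by simp
    finally have "(\<lambda>n. q ^ n) sums (1 / (1 - q))" by (rule geometric_sums)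
    from sums_mult[OF this, of "z / of_real (1 + \<gamma>)"]
    have "(\<lambda>n. fps_nth (disk_change_fps \<gamma>) (Suc n) * z ^ Suc n) sums (z / of_real (1 + \<gamma>) * (1 / (1 - q)))"
      by (simp add: disk_change_fps_def q_def power_mult_distrib power_divide mult_ac)
    moreover have "z / of_real (1 + \<gamma>) * (1 / (1 - q)) = z / (of_real (1 + \<gamma>) - of_real \<gamma> * z)"
    proof -
      have "complex_of_real (1 + \<gamma>) \<noteq> 0" using assms by (simp only: of_real_eq_0_iff)
      then have "of_real (1 + \<gamma>) * (1 - q) = of_real (1 + \<gamma>) - of_real \<gamma> * z"
        by (simp add: q_def algebra_simps del: of_real_add)
      then show ?thesis by (metis mult.right_neutral times_divide_times_eq)
    qed
    ultimately have "(\<lambda>n. fps_nth (disk_change_fps \<gamma>) (Suc n) * z ^ Suc n) sums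
        (z / (of_real (1 + \<gamma>) - of_real \<gamma> * z))" by (simp only:)
    then have "(\<lambda>n. fps_nth (disk_change_fps \<gamma>) n * z ^ n) sums
        (z / (of_real (1 + \<gamma>) - of_real \<gamma> * z) + fps_nth (disk_change_fps \<gamma>) 0 * z ^ 0)"
      by (subst (asm) sums_Suc_iff)
    then show ?thesis by (simp add: disk_change_fps_def)
  qed
  moreover have "eventually (\<lambda>z::complex. z \<in> ball 0 1) (nhds 0)"
    by (intro eventually_nhds_in_open) auto
  ultimately show "eventually (\<lambda>z. (\<lambda>n. fps_nth (disk_change_fps \<gamma>) n * z ^ n) sums
      (z / (of_real (1 + \<gamma>) - of_real \<gamma> * z))) (nhds 0)"
    by (auto elim: eventually_mono)
qed

lemma disk_change_fps_power_nonneg: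
  assumes "0 \<le> \<gamma>"
  shows "fps_nth (disk_change_fps \<gamma> ^ i) n \<in> \<real>\<^sub>\<ge>\<^sub>0"
proof (induction i arbitrary: n)
  case 0
  then show ?case by simp
next
  case (Suc i)
  have "fps_nth (disk_change_fps \<gamma>) j \<in> \<real>\<^sub>\<ge>\<^sub>0" for j
    using assms by (simp add: disk_change_fps_def del: of_real_divide of_real_power)
  then have "fps_nth (disk_change_fps \<gamma>) j * fps_nth (disk_change_fps \<gamma> ^ i) (n - j) \<in> \<real>\<^sub>\<ge>\<^sub>0" for j
    using Suc by (intro nonneg_Reals_mult_I)
  then show ?case
    unfolding complex_nonneg_Reals_iff power_Suc fps_mult_nth Re_sum Im_sum
    by (auto intro!: sum_nonneg sum.neutral)
qed

text \<open>The sum is the \<open>n\<close>-th coefficient of \<open>1 / (1 - b)\<close>, and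
  \<open>1 / (1 - b z) = (1 + \<gamma> - \<gamma> z) / ((1 + \<gamma>) (1 - z))\<close>.  The restriction \<open>n \<ge> 1\<close> matters: the zeroth
  coefficient is 1.\<close>
lemma sum_disk_change_fps_power:
  assumes "0 \<le> \<gamma>" "1 \<le> n"
  shows "(\<Sum>i=0..n. fps_nth (disk_change_fps \<gamma> ^ i) n) = of_real (1 / (1 + \<gamma>))"
proof -
  define B where "B = disk_change_fps \<gamma>"
  define G where "G = Abs_fps (\<lambda>_. 1 :: complex)"
  define D where "D = fps_const (complex_of_real (1 + \<gamma>)) - fps_const (of_real \<gamma>) * fps_X"
  have nz: "complex_of_real (1 + \<gamma>) \<noteq> 0" using assms by (simp only: of_real_eq_0_iff)
  have B0: "fps_nth B 0 = 0" by (simp add: B_def disk_change_fps_def)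
  have BD: "B * D = fps_X"
  proof (rule fps_ext)
    fix m
    have "B * D = fps_const (of_real (1 + \<gamma>)) * B - fps_const (of_real \<gamma>) * (B * fps_X)"
      unfolding D_def by (simp only: right_diff_distrib mult_ac)
    then have "fps_nth (B * D) m = of_real (1 + \<gamma>) * fps_nth B m - of_real \<gamma> * (if m = 0 then 0 else fps_nth B (m - 1))"
      by (simp only: fps_sub_nth fps_mult_left_const_nth fps_X_mult_right_nth)
    also have "\<dots> = fps_nth fps_X m"
      using nz by (cases m; cases "m - 1") (auto simp: B_def disk_change_fps_def fps_X_def simp del: of_real_add)
    finally show "fps_nth (B * D) m = fps_nth fps_X m" .
  qed
  have G: "(1 - fps_X) * G = 1"
    by (rule fps_ext) (auto simp: G_def left_diff_distrib)
  then have "((1 - fps_X) * G) oo B = 1" by simp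
  then have GB: "(1 - B) * (G oo B) = 1"
    by (simp add: fps_compose_mult_distrib[OF B0] fps_compose_sub_distrib B0)
  have D: "D - fps_X = fps_const (of_real (1 + \<gamma>)) * (1 - fps_X)"
    by (simp add: D_def algebra_simps flip: fps_const_add)
  have "fps_const (of_real (1 + \<gamma>)) * (G oo B) = (((1 - fps_X) * G) * fps_const (of_real (1 + \<gamma>))) * (G oo B)"
    by (simp add: G)
  also have "\<dots> = ((D - B * D) * (G oo B)) * G"
    unfolding BD D by (simp only: mult_ac)
  also have "\<dots> = D * ((1 - B) * (G oo B)) * G"
    by (simp add: algebra_simps)
  also have "\<dots> = D * G" by (simp add: GB)
  finally have "of_real (1 + \<gamma>) * fps_nth (G oo B) n = fps_nth (D * G) n"
    by (metis fps_mult_left_const_nth)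
  also have "\<dots> = 1"
    using assms(2) by (simp add: D_def G_def left_diff_distrib mult.assoc)
  finally have "fps_nth (G oo B) n = of_real (1 / (1 + \<gamma>))"
    using nz by (simp add: field_simps del: of_real_add)
  then show ?thesis
    by (simp add: fps_compose_nth G_def B_def)
qed

text \<open>Composition with \<open>b\<close> takes nonnegative combinations of the coefficients, so it preserves one-sided
  bounds.  The zeroth coefficient of \<open>P\<close> does not contribute because \<open>b\<^sup>0 = 1\<close> has no \<open>n\<close>-th one.\<close>
lemma Re_fps_nth_disk_change_le:
  assumes "0 \<le> \<gamma>" "1 \<le> n" and M: "\<And>k. 1 \<le> k \<Longrightarrow> Re (fps_nth P k) \<le> M"
  shows "Re (fps_nth (P oo disk_change_fps \<gamma>) n) \<le> M / (1 + \<gamma>)"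
proof -
  let ?b = "\<lambda>i. Re (fps_nth (disk_change_fps \<gamma> ^ i) n)"
  have b: "0 \<le> ?b i" "Im (fps_nth (disk_change_fps \<gamma> ^ i) n) = 0" for i
    using disk_change_fps_power_nonneg[OF assms(1)] by (auto simp: complex_nonneg_Reals_iff)
  have b0: "?b 0 = 0" using assms(2) by simp
  have "Re (fps_nth (P oo disk_change_fps \<gamma>) n) = (\<Sum>i=0..n. Re (fps_nth P i) * ?b i)"
    by (simp add: fps_compose_nth b)
  also have "\<dots> \<le> (\<Sum>i=0..n. M * ?b i)"
  proof (rule sum_mono)
    fix i
    show "Re (fps_nth P i) * ?b i \<le> M * ?b i"
      using M[of i] b(1)[of i] b0 by (cases "i = 0") (auto intro: mult_right_mono)
  qed
  also have "\<dots> = M * Re (\<Sum>i=0..n. fps_nth (disk_change_fps \<gamma> ^ i) n)"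
    by (simp add: sum_distrib_left)
  also have "\<dots> = M / (1 + \<gamma>)"
    unfolding sum_disk_change_fps_power[OF assms(1,2)] Re_complex_of_real by simp
  finally show ?thesis .
qed

text \<open>With \<open>\<psi>\<close> the Moebius map from the unit disk to \<open>Omega \<gamma>\<close> and \<open>b\<close> its inverse, the function \<open>f \<circ> \<psi>\<close> falls
  under \<open>Re_coeff_le_of_contractive\<close>, and near 0 the expansion of \<open>f = (f \<circ> \<psi>) \<circ> b\<close> is obtained by
  formal composition.\<close>
lemma admissible_coeff_bound:
  fixes f :: "complex \<Rightarrow> 'h::complex_hilbert_space \<Rightarrow>\<^sub>L 'h"
  assumes \<gamma>: "0 \<le> \<gamma>" "\<gamma> < 1" and adm: "admissible \<gamma> f A"
    and A0: "A 0 = \<alpha>\<^sub>0 *\<^sub>C id_blinfun" "cmod \<alpha>\<^sub>0 < 1" and n: "1 \<le> n"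
  shows "norm (A n) \<le> (1 - (cmod \<alpha>\<^sub>0)\<^sup>2) / (1 + \<gamma>)"
proof (rule norm_blinfun_le_if_Re_cinner_le)
  show "0 \<le> (1 - (cmod \<alpha>\<^sub>0)\<^sup>2) / (1 + \<gamma>)"
    using A0 \<gamma> by (intro divide_nonneg_pos) (auto simp: abs_square_le_1)
  fix u y :: 'h assume unit: "norm u = 1" "norm y = 1"
  define \<psi> where "\<psi> \<zeta> = of_real (1 + \<gamma>) * \<zeta> / (1 + of_real \<gamma> * \<zeta>)" for \<zeta> :: complex
  define b where "b z = z / (of_real (1 + \<gamma>) - of_real \<gamma> * z)" for z :: complex
  have den: "1 + of_real \<gamma> * \<zeta> \<noteq> 0" if "cmod \<zeta> < 1" for \<zeta> :: complex
    using cmod_real_add_less[OF \<gamma> that] by auto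
  have \<psi>: "\<psi> \<zeta> \<in> Omega \<gamma>" if \<zeta>: "cmod \<zeta> < 1" for \<zeta>
  proof -
    have "of_real \<gamma> + of_real (1 - \<gamma>) * \<psi> \<zeta> = (of_real \<gamma> + \<zeta>) / (1 + of_real \<gamma> * \<zeta>)"
      using den[OF \<zeta>] by (simp add: \<psi>_def divide_simps) (simp add: algebra_simps)
    then show ?thesis
      using cmod_real_add_less[OF \<gamma> \<zeta>] den[OF \<zeta>] \<gamma>
      by (simp add: Omega_iff norm_divide del: of_real_diff)
  qed
  have \<psi>b: "\<psi> (b z) = z" if "cmod z < 1" for z
  proof -
    have nz: "complex_of_real (1 + \<gamma>) \<noteq> 0" using \<gamma> by (simp only: of_real_eq_0_iff)
    have "cmod (of_real \<gamma> * z) < cmod (of_real (1 + \<gamma>))"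
      using \<gamma> that mult_left_le[of "cmod z" \<gamma>] unfolding norm_mult norm_of_real by simp
    then have d: "of_real (1 + \<gamma>) - of_real \<gamma> * z \<noteq> 0" by auto
    then have "1 + of_real \<gamma> * b z = of_real (1 + \<gamma>) / (of_real (1 + \<gamma>) - of_real \<gamma> * z)"
      unfolding b_def by (simp add: divide_simps)
    then show ?thesis
      using nz d by (simp add: \<psi>_def b_def del: of_real_add)
  qed
  define F where "F \<zeta> = f (\<psi> \<zeta>)" for \<zeta>
  have sums: "(\<lambda>n. z ^ n *\<^sub>C A n) sums f z" if "cmod z < 1" for z
    using adm that by (auto simp: admissible_def)
  have holo: "(\<lambda>z. cinner (blinfun_apply (F z) v) w) holomorphic_on ball 0 1" for v w
  proof -
    have "\<psi> holomorphic_on ball 0 1"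
      unfolding \<psi>_def using den by (intro holomorphic_intros) auto
    moreover have "(\<lambda>z. cinner (blinfun_apply (f z) v) w) holomorphic_on Omega \<gamma>"
      using adm by (intro holomorphic_on_cinner_apply) (auto simp: admissible_def)
    moreover have "\<psi> ` ball 0 1 \<subseteq> Omega \<gamma>" using \<psi> by auto
    ultimately have "((\<lambda>z. cinner (blinfun_apply (f z) v) w) \<circ> \<psi>) holomorphic_on ball 0 1"
      by (rule holomorphic_on_compose_gen)
    then show ?thesis by (simp add: F_def o_def)
  qed
  define P where "P = fps_expansion (\<lambda>z. cinner (blinfun_apply (F z) u) y) 0"
  have P: "(\<lambda>z. cinner (blinfun_apply (F z) u) y) has_fps_expansion P"
    unfolding P_def using holo by (intro has_fps_expansion_fps_expansion[of "ball 0 1"]) auto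
  have F0: "F 0 = A 0"
  proof -
    have "(\<lambda>n. 0 ^ n *\<^sub>C A n) sums A 0"
    proof -
      have "(0::complex) *\<^sub>C T = 0" "(1::complex) *\<^sub>C T = T" for T :: "'h \<Rightarrow>\<^sub>L 'h"
        using scaleR_scaleC[of 0 T] scaleR_scaleC[of 1 T] by simp_all
      then have "(\<lambda>n. 0 ^ n *\<^sub>C A n) = (\<lambda>n. if n = 0 then A n else 0)"
        by (auto simp: fun_eq_iff power_0_left)
      then show ?thesis using sums_single[of 0 A] by simp
    qed
    with sums[of 0] show ?thesis
      by (simp add: F_def \<psi>_def sums_unique2)
  qed
  have Re_P: "Re (fps_nth P k) \<le> 1 - (cmod \<alpha>\<^sub>0)\<^sup>2" if "1 \<le> k" for k
  proof (rule Re_coeff_le_of_contractive[OF holo _ _ _ P unit that])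
    show "F 0 = \<alpha>\<^sub>0 *\<^sub>C id_blinfun" using F0 A0 by simp
    show "F z \<in> bounded_operators" "norm (F z) \<le> 1" if "cmod z < 1" for z
      using adm \<psi>[OF that] by (simp_all add: F_def admissible_def)
  qed
  have "(\<lambda>z. cinner (blinfun_apply (f z) u) y) has_fps_expansion Abs_fps (\<lambda>n. cinner (blinfun_apply (A n) u) y)"
  proof (rule has_fps_expansionI)
    have "eventually (\<lambda>z::complex. z \<in> ball 0 1) (nhds 0)"
      by (intro eventually_nhds_in_open) auto
    then show "eventually (\<lambda>z. (\<lambda>n. fps_nth (Abs_fps (\<lambda>n. cinner (blinfun_apply (A n) u) y)) n * z ^ n) sums
        cinner (blinfun_apply (f z) u) y) (nhds 0)"
    proof eventually_elim
      case (elim z)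
      then show ?case
        using bounded_linear.sums[OF bounded_linear_cinner_apply[of u y] sums[of z]]
        by (simp add: scaleC_blinfun.rep_eq cinner_scaleC_left mult.commute)
    qed
  qed
  moreover have "(\<lambda>z. cinner (blinfun_apply (f z) u) y) has_fps_expansion (P oo disk_change_fps \<gamma>)"
  proof -
    have Fb: "((\<lambda>z. cinner (blinfun_apply (F z) u) y) \<circ> b) has_fps_expansion (P oo disk_change_fps \<gamma>)"
      unfolding b_def using P \<gamma>
      by (intro has_fps_expansion_compose disk_change_has_fps_expansion) (auto simp: disk_change_fps_def)
    have "eventually (\<lambda>z::complex. z \<in> ball 0 1) (nhds 0)"
      by (intro eventually_nhds_in_open) auto
    then have "eventually (\<lambda>z. ((\<lambda>z. cinner (blinfun_apply (F z) u) y) \<circ> b) z = cinner (blinfun_apply (f z) u) y) (nhds 0)"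
      by eventually_elim (simp add: F_def \<psi>b)
    from iffD1[OF has_fps_expansion_cong[OF this refl] Fb] show ?thesis .
  qed
  ultimately have "Abs_fps (\<lambda>n. cinner (blinfun_apply (A n) u) y) = P oo disk_change_fps \<gamma>"
    by (rule fps_expansion_unique_complex)
  then have "cinner (blinfun_apply (A n) u) y = fps_nth (P oo disk_change_fps \<gamma>) n"
    by (metis fps_nth_Abs_fps)
  then show "Re (cinner (blinfun_apply (A n) u) y) \<le> (1 - (cmod \<alpha>\<^sub>0)\<^sup>2) / (1 + \<gamma>)"
    using Re_fps_nth_disk_change_le[OF \<gamma>(1) n Re_P] by simp
qed

section \<open>Cesaro weights and the Bohr sum\<close>

lemma cesaro_coeff_0 [simp]: "cesaro_coeff \<alpha> 0 = 1"
  by (simp add: cesaro_coeff_def)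

lemma cesaro_coeff_Suc: "cesaro_coeff \<alpha> (Suc n) = cesaro_coeff \<alpha> n * (\<alpha> + real n + 1) / (real n + 1)"
  by (simp add: cesaro_coeff_def field_simps)

lemma cesaro_coeff_pos: "-1 < \<alpha> \<Longrightarrow> 0 < cesaro_coeff \<alpha> n"
  unfolding cesaro_coeff_def by (intro divide_pos_pos prod_pos) auto

lemma cesaro_coeff_shift:
  assumes "-1 < \<alpha>"
  shows "(\<alpha> + 1) * cesaro_coeff (\<alpha> + 1) n = cesaro_coeff \<alpha> n * (\<alpha> + real n + 1)"
proof (induction n)
  case (Suc n)
  have "(\<alpha> + 1) * cesaro_coeff (\<alpha> + 1) (Suc n) =
      ((\<alpha> + 1) * cesaro_coeff (\<alpha> + 1) n) * (\<alpha> + real n + 2) / (real n + 1)"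
    by (simp add: cesaro_coeff_Suc algebra_simps)
  also have "\<dots> = cesaro_coeff \<alpha> (Suc n) * (\<alpha> + real (Suc n) + 1)"
    unfolding Suc by (simp add: cesaro_coeff_Suc algebra_simps)
  finally show ?case .
qed auto

lemma cesaro_coeff_ratio:
  assumes "-1 < \<alpha>"
  shows "cesaro_coeff \<alpha> n / cesaro_coeff (\<alpha> + 1) n = (\<alpha> + 1) / (\<alpha> + real n + 1)"
  using cesaro_coeff_shift[OF assms, of n] cesaro_coeff_pos[of "\<alpha> + 1" n] assms
  by (simp add: field_simps)

text \<open>This is the coefficient form of \<open>(1 - z)\<^bsup>-(\<alpha>+1)\<^esup> / (1 - z) = (1 - z)\<^bsup>-(\<alpha>+2)\<^esup>\<close>.\<close>
lemma sum_cesaro_coeff: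
  assumes "-1 < \<alpha>"
  shows "(\<Sum>k=0..n. cesaro_coeff \<alpha> k) = cesaro_coeff (\<alpha> + 1) n"
proof (induction n)
  case (Suc n)
  have "cesaro_coeff \<alpha> (Suc n) = (\<alpha> + 1) * cesaro_coeff (\<alpha> + 1) n / (real n + 1)"
    by (simp only: cesaro_coeff_Suc cesaro_coeff_shift[OF assms])
  then have "cesaro_coeff (\<alpha> + 1) n + cesaro_coeff \<alpha> (Suc n) = cesaro_coeff (\<alpha> + 1) (Suc n)"
    by (simp add: cesaro_coeff_Suc field_simps)
  with Suc show ?case by simp
qed auto

definition cesaro_weight :: "real \<Rightarrow> nat \<Rightarrow> nat \<Rightarrow> real"
  where "cesaro_weight \<alpha> n k = cesaro_coeff \<alpha> (n - k) / cesaro_coeff (\<alpha> + 1) n"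

lemma cesaro_weight_nonneg: "-1 < \<alpha> \<Longrightarrow> 0 \<le> cesaro_weight \<alpha> n k"
  by (simp add: cesaro_weight_def cesaro_coeff_pos less_imp_le)

text \<open>The weights of a whole row sum to 1, and the missing weight of index 0 is the subtracted
  fraction.\<close>
lemma sum_cesaro_weight:
  assumes "-1 < \<alpha>"
  shows "(\<Sum>k=1..n. cesaro_weight \<alpha> n k) = 1 - (\<alpha> + 1) / (\<alpha> + real n + 1)"
proof -
  have "(\<Sum>k=0..n. cesaro_coeff \<alpha> (n - k)) = cesaro_coeff (\<alpha> + 1) n"
    using sum.atLeastAtMost_rev[of "cesaro_coeff \<alpha>" 0 n] sum_cesaro_coeff[OF assms] by simp
  then have "(\<Sum>k=0..n. cesaro_weight \<alpha> n k) = 1"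
    using cesaro_coeff_pos[of "\<alpha> + 1" n] assms
    by (simp add: cesaro_weight_def flip: sum_divide_distrib)
  moreover have "cesaro_weight \<alpha> n 0 = (\<alpha> + 1) / (\<alpha> + real n + 1)"
    using cesaro_coeff_ratio[OF assms] by (simp add: cesaro_weight_def)
  ultimately show ?thesis
    by (simp add: sum.atLeast_Suc_atMost[of 0 n])
qed

text \<open>The coefficient \<open>A 0\<close> contributes a multiple of the comparison series; only the other ones have
  to be estimated.\<close>
lemma cesaro_bohr_term_eq:
  assumes "-1 < \<alpha>"
  shows "cesaro_bohr_term \<alpha> A r n =
    norm (A 0) * ((\<alpha> + 1) * (r ^ n / (\<alpha> + real n + 1))) +
    r ^ n * (\<Sum>k=1..n. cesaro_weight \<alpha> n k * norm (A k))"
proof -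
  have "cesaro_bohr_term \<alpha> A r n = (\<Sum>k=0..n. cesaro_weight \<alpha> n k * norm (A k)) * r ^ n"
    by (simp add: cesaro_bohr_term_def cesaro_weight_def sum_distrib_left)
  also have "(\<Sum>k=0..n. cesaro_weight \<alpha> n k * norm (A k)) =
      cesaro_weight \<alpha> n 0 * norm (A 0) + (\<Sum>k=1..n. cesaro_weight \<alpha> n k * norm (A k))"
    by (simp add: sum.atLeast_Suc_atMost[of 0 n])
  also have "cesaro_weight \<alpha> n 0 = (\<alpha> + 1) / (\<alpha> + real n + 1)"
    using cesaro_coeff_ratio[OF assms] by (simp add: cesaro_weight_def)
  finally show ?thesis
    by (simp add: algebra_simps)
qed

lemma cesaro_bohr_sum_le:
  fixes A :: "nat \<Rightarrow> 'a::real_normed_vector"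
  assumes \<alpha>: "-1 < \<alpha>" and r: "0 \<le> r" "r < 1"
    and M: "\<And>n. 1 \<le> n \<Longrightarrow> norm (A n) \<le> M"
  shows "summable (cesaro_bohr_term \<alpha> A r)"
    and "cesaro_bohr_sum \<alpha> A r \<le>
      norm (A 0) * ((\<alpha> + 1) * cesaro_series \<alpha> r) +
      M * (1 / (1 - r) - (\<alpha> + 1) * cesaro_series \<alpha> r)"
proof -
  define S where "S = (\<alpha> + 1) * cesaro_series \<alpha> r"
  define s where "s n = (\<alpha> + 1) * (r ^ n / (\<alpha> + real n + 1))" for n
  have s: "s sums S"
    unfolding s_def S_def cesaro_series_def
    using summable_cesaro_series[of \<alpha> r] \<alpha> r by (intro sums_mult summable_sums) auto
  have g: "(\<lambda>n. r ^ n) sums (1 / (1 - r))"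
    using r by (intro geometric_sums) auto
  have bound: "(\<lambda>n. norm (A 0) * s n + M * (r ^ n - s n)) sums
      (norm (A 0) * S + M * (1 / (1 - r) - S))"
    by (intro sums_add sums_mult sums_diff s g)
  have le: "cesaro_bohr_term \<alpha> A r n \<le> norm (A 0) * s n + M * (r ^ n - s n)" for n
  proof -
    have "(\<Sum>k=1..n. cesaro_weight \<alpha> n k * norm (A k)) \<le>
        (\<Sum>k=1..n. cesaro_weight \<alpha> n k * M)"
      using M by (intro sum_mono mult_left_mono cesaro_weight_nonneg \<alpha>) auto
    also have "\<dots> = M * (1 - (\<alpha> + 1) / (\<alpha> + real n + 1))"
      by (subst sum_distrib_right[symmetric], subst sum_cesaro_weight[OF \<alpha>]) simp
    finally have "r ^ n * (\<Sum>k=1..n. cesaro_weight \<alpha> n k * norm (A k)) \<le>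
        r ^ n * (M * (1 - (\<alpha> + 1) / (\<alpha> + real n + 1)))"
      using r by (intro mult_left_mono) auto
    also have "\<dots> = M * (r ^ n - s n)"
      by (simp add: s_def algebra_simps)
    finally show ?thesis
      unfolding cesaro_bohr_term_eq[OF \<alpha>] s_def by simp
  qed
  have nonneg: "0 \<le> cesaro_bohr_term \<alpha> A r n" for n
  proof -
    have "0 \<le> s n" using \<alpha> r by (simp add: s_def)
    moreover have "0 \<le> r ^ n * (\<Sum>k=1..n. cesaro_weight \<alpha> n k * norm (A k))"
      using \<alpha> r by (intro mult_nonneg_nonneg sum_nonneg cesaro_weight_nonneg) auto
    ultimately show ?thesis
      unfolding cesaro_bohr_term_eq[OF \<alpha>] s_def
      by (intro add_nonneg_nonneg mult_nonneg_nonneg[OF norm_ge_zero])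
  qed
  show summable: "summable (cesaro_bohr_term \<alpha> A r)"
    using le nonneg by (intro summable_comparison_test'[OF sums_summable[OF bound]]) auto
  show "cesaro_bohr_sum \<alpha> A r \<le>
      norm (A 0) * ((\<alpha> + 1) * cesaro_series \<alpha> r) +
      M * (1 / (1 - r) - (\<alpha> + 1) * cesaro_series \<alpha> r)"
    using sums_le[OF le summable_sums[OF summable] bound]
    by (simp add: cesaro_bohr_sum_def S_def)
qed

lemma cesaro_bohr_sum_ge:
  fixes A :: "nat \<Rightarrow> 'a::real_normed_vector"
  assumes \<alpha>: "-1 < \<alpha>" and r: "0 \<le> r" "r < 1"
    and summable: "summable (cesaro_bohr_term \<alpha> A r)"
  shows "norm (A 0) * ((\<alpha> + 1) * cesaro_series \<alpha> r) +
      (\<Sum>n<N. r ^ n * (\<Sum>k=1..n. cesaro_weight \<alpha> n k * norm (A k))) \<le> cesaro_bohr_sum \<alpha> A r"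
proof -
  let ?s = "\<lambda>n. (\<alpha> + 1) * (r ^ n / (\<alpha> + real n + 1))"
  let ?t = "\<lambda>n. r ^ n * (\<Sum>k=1..n. cesaro_weight \<alpha> n k * norm (A k))"
  have "(\<lambda>n. norm (A 0) * ?s n) sums (norm (A 0) * ((\<alpha> + 1) * cesaro_series \<alpha> r))"
    unfolding cesaro_series_def
    using summable_cesaro_series[of \<alpha> r] \<alpha> r by (intro sums_mult summable_sums) auto
  note diff = sums_diff[OF summable_sums[OF summable] this]
  have "cesaro_bohr_term \<alpha> A r n - norm (A 0) * ?s n = ?t n" for n
    by (simp add: cesaro_bohr_term_eq[OF \<alpha>])
  with diff have t: "?t sums (cesaro_bohr_sum \<alpha> A r - norm (A 0) * ((\<alpha> + 1) * cesaro_series \<alpha> r))"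
    by (simp only: cesaro_bohr_sum_def)
  have "sum ?t {..<N} \<le> suminf ?t"
    using \<alpha> r t
    by (intro sum_le_suminf mult_nonneg_nonneg sum_nonneg cesaro_weight_nonneg)
      (auto simp: sums_iff)
  with t show ?thesis by (simp add: sums_iff)
qed

section \<open>The comparison series and its integral\<close>

lemma DERIV_cesaro_series:
  assumes \<alpha>: "-1 < \<alpha>" and r: "\<bar>r\<bar> < 1"
  shows "(cesaro_series \<alpha> has_real_derivative (\<Sum>n. diffs (\<lambda>n. 1 / (\<alpha> + real n + 1)) n * r ^ n)) (at r)"
proof -
  have "((\<lambda>x. \<Sum>n. 1 / (\<alpha> + real n + 1) * x ^ n) has_real_derivative
      (\<Sum>n. diffs (\<lambda>n. 1 / (\<alpha> + real n + 1)) n * r ^ n)) (at r)"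
    using summable_cesaro_series[OF \<alpha>] r by (intro termdiffs_strong'[where K = 1]) auto
  moreover have "(\<lambda>x. \<Sum>n. 1 / (\<alpha> + real n + 1) * x ^ n) = cesaro_series \<alpha>"
    by (auto simp: cesaro_series_def)
  ultimately show ?thesis by simp
qed

text \<open>With \<open>G\<close> the series, \<open>(\<alpha> + 1) G + r G' = 1 / (1 - r)\<close>, since \<open>(\<alpha> + 1) + n\<close> cancels the denominator
  of the \<open>n\<close>-th term.\<close>
lemma cesaro_series_ODE:
  assumes \<alpha>: "-1 < \<alpha>" and r: "\<bar>r\<bar> < 1"
  shows "(\<alpha> + 1) * cesaro_series \<alpha> r + r * (\<Sum>n. diffs (\<lambda>n. 1 / (\<alpha> + real n + 1)) n * r ^ n) = 1 / (1 - r)"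
proof -
  let ?c = "\<lambda>n. 1 / (\<alpha> + real n + 1)"
  have sum: "summable (\<lambda>n. ?c n * x ^ n)" if "norm x < 1" for x
    using summable_cesaro_series[OF \<alpha>] that by auto
  have "summable (\<lambda>n. diffs ?c n * r ^ n)"
    using r by (intro termdiff_converges[where K = 1] sum) auto
  then have "(\<lambda>n. real n * ?c n * r ^ (n - Suc 0)) sums (\<Sum>n. diffs ?c n * r ^ n)"
    using diffs_equiv[of ?c r] by simp
  from sums_mult[OF this, of r]
  have "(\<lambda>n. real n * ?c n * r ^ n) sums (r * (\<Sum>n. diffs ?c n * r ^ n))"
  proof (rule sums_cong[THEN iffD1, rotated])
    show "r * (real n * ?c n * r ^ (n - Suc 0)) = real n * ?c n * r ^ n" for n
      by (cases n) auto
  qed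
  moreover have "(\<lambda>n. (\<alpha> + 1) * (r ^ n / (\<alpha> + real n + 1))) sums ((\<alpha> + 1) * cesaro_series \<alpha> r)"
    unfolding cesaro_series_def using summable_cesaro_series[OF \<alpha> r] by (intro sums_mult summable_sums)
  ultimately have "(\<lambda>n. (\<alpha> + 1) * (r ^ n / (\<alpha> + real n + 1)) + real n * ?c n * r ^ n) sums
      ((\<alpha> + 1) * cesaro_series \<alpha> r + r * (\<Sum>n. diffs ?c n * r ^ n))"
    by (rule sums_add[rotated])
  moreover have "(\<alpha> + 1) * (r ^ n / (\<alpha> + real n + 1)) + real n * ?c n * r ^ n = r ^ n" for n
  proof -
    have "\<alpha> + real n + 1 \<noteq> 0" using \<alpha> by auto
    then show ?thesis by (simp add: divide_simps) (simp add: algebra_simps)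
  qed
  ultimately have "(\<lambda>n. r ^ n) sums ((\<alpha> + 1) * cesaro_series \<alpha> r + r * (\<Sum>n. diffs ?c n * r ^ n))"
    by simp
  moreover have "(\<lambda>n. r ^ n) sums (1 / (1 - r))"
    using r by (intro geometric_sums) auto
  ultimately show ?thesis by (rule sums_unique2)
qed

text \<open>The antiderivative is \<open>t\<^bsup>\<alpha>+1\<^esup> G t\<close> with \<open>G\<close> the comparison series.  It is continuous at 0 because
  \<open>\<alpha> + 1 > 0\<close>, even where the integrand is unbounded.\<close>
lemma has_integral_powr_over_one_minus:
  assumes \<alpha>: "-1 < \<alpha>" and r: "0 < r" "r < 1"
  shows "((\<lambda>t. t powr \<alpha> / (1 - t)) has_integral (r powr (\<alpha> + 1) * cesaro_series \<alpha> r)) {0..r}"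
proof -
  define F where "F t = t powr (\<alpha> + 1) * cesaro_series \<alpha> t" for t
  have "((\<lambda>t. t powr \<alpha> / (1 - t)) has_integral (F r - F 0)) {0..r}"
  proof (rule fundamental_theorem_of_calculus_interior)
    have "continuous_on {0..r} (cesaro_series \<alpha>)"
      using DERIV_cesaro_series[OF \<alpha>] r
      by (intro DERIV_continuous_on[of _ _ "\<lambda>x. (\<Sum>n. diffs (\<lambda>n. 1 / (\<alpha> + real n + 1)) n * x ^ n)"])
        (auto intro: has_field_derivative_at_within)
    then show "continuous_on {0..r} F"
      unfolding F_def using \<alpha>
      by (intro continuous_on_mult continuous_on_powr' continuous_on_id continuous_on_const) auto
    fix t assume t: "t \<in> {0<..<r}"
    let ?d = "\<Sum>n. diffs (\<lambda>n. 1 / (\<alpha> + real n + 1)) n * t ^ n"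
    have "(F has_real_derivative ((\<alpha> + 1) * t powr \<alpha> * cesaro_series \<alpha> t + ?d * t powr (\<alpha> + 1))) (at t)"
      unfolding F_def using t r
      by (auto intro!: derivative_eq_intros DERIV_cesaro_series[OF \<alpha>])
    also have "(\<alpha> + 1) * t powr \<alpha> * cesaro_series \<alpha> t + ?d * t powr (\<alpha> + 1) =
        t powr \<alpha> * ((\<alpha> + 1) * cesaro_series \<alpha> t + t * ?d)"
      using t by (simp add: powr_add algebra_simps)
    also have "\<dots> = t powr \<alpha> / (1 - t)"
      using t r by (subst cesaro_series_ODE[OF \<alpha>]) auto
    finally show "(F has_vector_derivative (t powr \<alpha> / (1 - t))) (at t)"
      by (simp add: has_real_derivative_iff_has_vector_derivative)
  qed (use r in auto)
  then show ?thesis using \<alpha> by (simp add: F_def)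
qed

section \<open>The radius\<close>

text \<open>Multiplying by \<open>1 - r\<close> turns the coefficients into their differences.  After the constant term all
  of these are negative, which gives monotonicity, and they telescope, which gives the limit at 1.\<close>
lemma cesaro_series_times_one_minus:
  assumes \<alpha>: "-1 < \<alpha>" and r: "0 \<le> r" "r < 1"
  shows "(\<lambda>n. r ^ Suc n / ((\<alpha> + real n + 1) * (\<alpha> + real n + 2))) sums
    (1 / (\<alpha> + 1) - (1 - r) * cesaro_series \<alpha> r)"
proof -
  have s: "(\<lambda>n. r ^ n / (\<alpha> + real n + 1)) sums cesaro_series \<alpha> r"
    unfolding cesaro_series_def
    using summable_cesaro_series[of \<alpha> r] \<alpha> r by (intro summable_sums) auto
  from s have "(\<lambda>n. r ^ Suc n / (\<alpha> + real (Suc n) + 1)) sums (cesaro_series \<alpha> r - 1 / (\<alpha> + 1))"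
    by (subst sums_Suc_iff) simp
  from sums_diff[OF sums_mult[OF s, of r] this]
  have "(\<lambda>n. r * (r ^ n / (\<alpha> + real n + 1)) - r ^ Suc n / (\<alpha> + real (Suc n) + 1)) sums
      (1 / (\<alpha> + 1) - (1 - r) * cesaro_series \<alpha> r)"
    by (simp add: algebra_simps)
  moreover have "r * (r ^ n / (\<alpha> + real n + 1)) - r ^ Suc n / (\<alpha> + real (Suc n) + 1) =
      r ^ Suc n / ((\<alpha> + real n + 1) * (\<alpha> + real n + 2))" for n
  proof -
    have "\<alpha> + real n + 1 \<noteq> 0" "\<alpha> + real n + 2 \<noteq> 0" using \<alpha> by auto
    then show ?thesis by (simp add: divide_simps) (simp add: algebra_simps)
  qed
  ultimately show ?thesis by simp
qed

lemma one_minus_times_cesaro_series_strict_decreasing: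
  assumes \<alpha>: "-1 < \<alpha>" and "0 \<le> r" "r < s" "s < 1"
  shows "(1 - s) * cesaro_series \<alpha> s < (1 - r) * cesaro_series \<alpha> r"
proof -
  have "(\<lambda>n. s ^ Suc n / ((\<alpha> + real n + 1) * (\<alpha> + real n + 2)) -
      r ^ Suc n / ((\<alpha> + real n + 1) * (\<alpha> + real n + 2))) sums
      ((1 / (\<alpha> + 1) - (1 - s) * cesaro_series \<alpha> s) - (1 / (\<alpha> + 1) - (1 - r) * cesaro_series \<alpha> r))"
    using assms by (intro sums_diff cesaro_series_times_one_minus) auto
  moreover have "0 < s ^ Suc n / ((\<alpha> + real n + 1) * (\<alpha> + real n + 2)) -
      r ^ Suc n / ((\<alpha> + real n + 1) * (\<alpha> + real n + 2))" for n
    using assms by (simp add: divide_strict_right_mono power_strict_mono del: power_Suc)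
  ultimately have "0 < (1 / (\<alpha> + 1) - (1 - s) * cesaro_series \<alpha> s) -
      (1 / (\<alpha> + 1) - (1 - r) * cesaro_series \<alpha> r)"
    using suminf_pos[of "\<lambda>n. s ^ Suc n / ((\<alpha> + real n + 1) * (\<alpha> + real n + 2)) -
      r ^ Suc n / ((\<alpha> + real n + 1) * (\<alpha> + real n + 2))"] by (simp only: sums_iff) 
  then show ?thesis by simp
qed

lemma sum_inverse_consecutive:
  assumes "-1 < \<alpha>"
  shows "(\<Sum>n<N. 1 / ((\<alpha> + real n + 1) * (\<alpha> + real n + 2))) = 1 / (\<alpha> + 1) - 1 / (\<alpha> + real N + 1)"
proof (induction N)
  case (Suc N)
  have "\<alpha> + real N + 1 \<noteq> 0" "\<alpha> + real N + 2 \<noteq> 0" using assms by auto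
  then have "1 / ((\<alpha> + real N + 1) * (\<alpha> + real N + 2)) = 1 / (\<alpha> + real N + 1) - 1 / (\<alpha> + real (Suc N) + 1)"
    by (simp add: divide_simps)
  with Suc show ?case by simp
qed simp

text \<open>Truncating the series of negative terms after \<open>N\<close> of them leaves an upper bound that is a
  polynomial in \<open>r\<close>, with the value \<open>1 / (\<alpha> + N + 1)\<close> at 1.\<close>
lemma ex_one_minus_times_cesaro_series_less:
  assumes \<alpha>: "-1 < \<alpha>" and "0 < \<epsilon>"
  shows "\<exists>r. 0 < r \<and> r < 1 \<and> (1 - r) * cesaro_series \<alpha> r < \<epsilon>"
proof -
  obtain N :: nat where N: "1 / \<epsilon> < real N"
    using reals_Archimedean2 by blast
  define q where "q r = 1 / (\<alpha> + 1) - (\<Sum>n<N. r ^ Suc n / ((\<alpha> + real n + 1) * (\<alpha> + real n + 2)))" for r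
  have "(q \<longlongrightarrow> q 1) (at_left 1)"
    unfolding q_def using \<alpha> by (intro tendsto_intros) (auto simp: add_pos_nonneg)
  moreover have "q 1 < \<epsilon>"
  proof -
    have "q 1 = 1 / (\<alpha> + real N + 1)"
      using sum_inverse_consecutive[OF \<alpha>, of N] by (simp add: q_def)
    also have "\<dots> < \<epsilon>"
    proof -
      have "1 / \<epsilon> < \<alpha> + real N + 1" using N \<alpha> by simp
      moreover have "0 < \<alpha> + real N + 1" using \<alpha> by simp
      ultimately show ?thesis using \<open>0 < \<epsilon>\<close> by (simp add: field_simps)
    qed
    finally show ?thesis .
  qed
  ultimately have "eventually (\<lambda>r. q r < \<epsilon>) (at_left 1)"
    by (rule order_tendstoD)
  moreover have "eventually (\<lambda>r. r \<in> {0<..<1}) (at_left (1::real))"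
    by (intro eventually_at_leftI[of 0]) auto
  ultimately have "eventually (\<lambda>r. q r < \<epsilon> \<and> r \<in> {0<..<1}) (at_left (1::real))"
    by eventually_elim simp
  then obtain r where r: "q r < \<epsilon>" "0 < r" "r < 1"
    using eventually_happens'[of "at_left (1::real)"] by force
  have "(\<Sum>n<N. r ^ Suc n / ((\<alpha> + real n + 1) * (\<alpha> + real n + 2))) \<le>
      (\<Sum>n. r ^ Suc n / ((\<alpha> + real n + 1) * (\<alpha> + real n + 2)))"
    using cesaro_series_times_one_minus[OF \<alpha>, of r] r \<alpha>
    by (intro sum_le_suminf) (auto simp: sums_iff)
  also have "\<dots> = 1 / (\<alpha> + 1) - (1 - r) * cesaro_series \<alpha> r"
    using cesaro_series_times_one_minus[OF \<alpha>, of r] r by (simp add: sums_iff)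
  finally have "(1 - r) * cesaro_series \<alpha> r \<le> q r"
    by (simp add: q_def)
  with r show ?thesis by force
qed

lemma cesaro_radius_fun_eq:
  "r < 1 \<Longrightarrow> cesaro_radius_fun \<gamma> \<alpha> r = ((3 + \<gamma>) * (1 + \<alpha>) * ((1 - r) * cesaro_series \<alpha> r) - 2) / (1 - r)"
  by (simp add: cesaro_radius_fun_def field_simps)

text \<open>Up to the positive factor \<open>1 / (1 - r)\<close> the radius function is strictly decreasing, positive at 0 and
  negative close to 1.\<close>
lemma ex_cesaro_radius:
  assumes \<gamma>: "0 \<le> \<gamma>" and \<alpha>: "-1 < \<alpha>"
  obtains R where "0 < R" "R < 1" "cesaro_radius_fun \<gamma> \<alpha> R = 0"
    "\<And>r. 0 \<le> r \<Longrightarrow> r < R \<Longrightarrow> 0 < cesaro_radius_fun \<gamma> \<alpha> r"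
    "\<And>r. R < r \<Longrightarrow> r < 1 \<Longrightarrow> cesaro_radius_fun \<gamma> \<alpha> r < 0"
proof -
  define K where "K = (3 + \<gamma>) * (1 + \<alpha>)"
  have K: "0 < K" using assms by (simp add: K_def)
  define h where "h r = K * ((1 - r) * cesaro_series \<alpha> r) - 2" for r
  have h: "cesaro_radius_fun \<gamma> \<alpha> r = h r / (1 - r)" if "r < 1" for r
    using cesaro_radius_fun_eq[OF that] by (simp add: h_def K_def)
  have decr: "h s < h r" if "0 \<le> r" "r < s" "s < 1" for r s
    using one_minus_times_cesaro_series_strict_decreasing[OF \<alpha> that] K by (simp add: h_def)
  have h0: "0 < h 0"
  proof -
    have "cesaro_series \<alpha> 0 = 1 / (\<alpha> + 1)"
      using powser_zero[of "\<lambda>n. 1 / (\<alpha> + real n + 1)"] by (simp add: cesaro_series_def)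
    then have "(1 + \<alpha>) * cesaro_series \<alpha> 0 = 1" using \<alpha> by simp
    then have "h 0 = 1 + \<gamma>" by (simp add: h_def K_def mult.assoc)
    then show ?thesis using \<gamma> by simp
  qed
  obtain r1 where r1: "0 < r1" "r1 < 1" "(1 - r1) * cesaro_series \<alpha> r1 < 2 / K"
    using ex_one_minus_times_cesaro_series_less[OF \<alpha>, of "2 / K"] K by auto
  then have "h r1 < 0" using K by (simp add: h_def field_simps)
  moreover have "continuous_on {0..r1} h"
    unfolding h_def
    using DERIV_cesaro_series[OF \<alpha>] r1
    by (intro continuous_intros
        DERIV_continuous_on[of _ _ "\<lambda>x. (\<Sum>n. diffs (\<lambda>n. 1 / (\<alpha> + real n + 1)) n * x ^ n)"])
      (auto intro: has_field_derivative_at_within)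
  ultimately obtain R where R: "0 \<le> R" "R \<le> r1" "h R = 0"
    using IVT2'[of h r1 0 0] h0 r1 by auto
  show ?thesis
  proof (rule that)
    show "0 < R" "R < 1" using R h0 r1 by (auto simp: less_le)
    show "cesaro_radius_fun \<gamma> \<alpha> R = 0" using R r1 by (simp add: h)
    show "0 < cesaro_radius_fun \<gamma> \<alpha> r" if "0 \<le> r" "r < R" for r
      using decr[OF that] R r1 that by (simp add: h)
    show "cesaro_radius_fun \<gamma> \<alpha> r < 0" if "R < r" "r < 1" for r
      using decr[OF _ that] R that by (simp add: h divide_neg_pos)
  qed
qed

section \<open>The Bohr inequality up to the radius\<close>

text \<open>Everything reduces to \<open>2 E \<le> (1 + \<gamma>) S\<close>, where \<open>S\<close> is the right-hand side and \<open>E = 1 / (1 - r) - S\<close>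
  is the total weight that the coefficients beyond the zeroth receive.\<close>
lemma cesaro_bohr_inequality:
  fixes f :: "complex \<Rightarrow> 'h::complex_hilbert_space \<Rightarrow>\<^sub>L 'h"
  assumes \<gamma>: "0 \<le> \<gamma>" "\<gamma> < 1" and \<alpha>: "-1 < \<alpha>" and adm: "admissible \<gamma> f A"
    and r: "0 \<le> r" "r < 1" and nonneg: "0 \<le> cesaro_radius_fun \<gamma> \<alpha> r"
  shows "summable (cesaro_bohr_term \<alpha> A r)"
    and "cesaro_bohr_sum \<alpha> A r \<le> (\<alpha> + 1) * cesaro_series \<alpha> r"
proof -
  obtain \<alpha>\<^sub>0 where \<alpha>\<^sub>0: "A 0 = \<alpha>\<^sub>0 *\<^sub>C id_blinfun" "cmod \<alpha>\<^sub>0 < 1"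
    using adm by (auto simp: admissible_def)
  define p where "p = cmod \<alpha>\<^sub>0"
  have p: "0 \<le> p" "p < 1" using \<alpha>\<^sub>0 by (auto simp: p_def)
  define M where "M = (1 - p\<^sup>2) / (1 + \<gamma>)"
  have M: "norm (A n) \<le> M" if "1 \<le> n" for n
    using admissible_coeff_bound[OF \<gamma> adm \<alpha>\<^sub>0 that] by (simp add: M_def p_def)
  show "summable (cesaro_bohr_term \<alpha> A r)"
    by (rule cesaro_bohr_sum_le(1)[OF \<alpha> r M])
  define S where "S = (\<alpha> + 1) * cesaro_series \<alpha> r"
  define E where "E = 1 / (1 - r) - S"
  have S: "0 \<le> S"
    unfolding S_def cesaro_series_def using \<alpha> r summable_cesaro_series[of \<alpha> r]
    by (intro mult_nonneg_nonneg suminf_nonneg) auto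
  have E: "2 * E \<le> (1 + \<gamma>) * S"
    using nonneg by (simp add: cesaro_radius_fun_def E_def S_def algebra_simps)
  have "cesaro_bohr_sum \<alpha> A r \<le> norm (A 0) * S + M * E"
    unfolding S_def E_def by (rule cesaro_bohr_sum_le(2)[OF \<alpha> r M])
  also have "norm (A 0) * S \<le> p * S"
    using S mult_left_mono[OF norm_id_blinfun_le[where 'a = 'h], of p]
    by (intro mult_right_mono) (auto simp: \<alpha>\<^sub>0 norm_scaleC p_def)
  also have "M * E \<le> (1 - p) * S"
  proof -
    have "M * E \<le> M * ((1 + \<gamma>) / 2 * S)"
      using E p \<gamma> by (intro mult_left_mono) (auto simp: M_def abs_square_le_1)
    also have "\<dots> = (1 - p) * S * ((1 + p) / 2)"
      using \<gamma> by (simp add: M_def power2_eq_square) (simp add: algebra_simps)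
    also have "\<dots> \<le> (1 - p) * S"
      using p S by (intro mult_left_le) auto
    finally show ?thesis .
  qed
  finally have "cesaro_bohr_sum \<alpha> A r \<le> S"
    by (simp add: algebra_simps)
  then show "cesaro_bohr_sum \<alpha> A r \<le> (\<alpha> + 1) * cesaro_series \<alpha> r"
    by (simp only: S_def)
qed

section \<open>The extremal functions\<close>

text \<open>The disk automorphism \<open>w \<mapsto> (a - w) / (1 - a w)\<close> at \<open>w = \<gamma> + (1 - \<gamma>) z\<close>; this affine map takes
  \<open>Omega \<gamma>\<close> onto the unit disk.\<close>
definition moebius_extremal :: "real \<Rightarrow> real \<Rightarrow> complex \<Rightarrow> complex"
  where "moebius_extremal \<gamma> a z =
    (of_real a - (of_real \<gamma> + of_real (1 - \<gamma>) * z)) / (1 - of_real a * (of_real \<gamma> + of_real (1 - \<gamma>) * z))"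

text \<open>Expanding \<open>1 / a - (1 - a\<^sup>2) / (a (1 - a w))\<close> as a geometric series in \<open>z\<close>.\<close>
definition moebius_extremal_coeff :: "real \<Rightarrow> real \<Rightarrow> nat \<Rightarrow> real"
  where "moebius_extremal_coeff \<gamma> a n = (if n = 0 then 1 / a else 0) -
    (1 - a\<^sup>2) / (a * (1 - a * \<gamma>)) * (a * (1 - \<gamma>) / (1 - a * \<gamma>)) ^ n"

context
  fixes \<gamma> a :: real
  assumes \<gamma>: "0 \<le> \<gamma>" "\<gamma> < a" and a: "a < 1"
begin

lemma one_minus_pos: "0 < 1 - a * \<gamma>"
  using \<gamma> a mult_strict_mono'[of a 1 \<gamma> 1] by simp

lemma moebius_extremal_coeff_0: "moebius_extremal_coeff \<gamma> a 0 = (a - \<gamma>) / (1 - a * \<gamma>)"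
  using one_minus_pos \<gamma> by (simp add: moebius_extremal_coeff_def field_simps power2_eq_square)

lemma moebius_extremal_coeff_0_bounds:
  "0 \<le> moebius_extremal_coeff \<gamma> a 0" "moebius_extremal_coeff \<gamma> a 0 < 1"
proof -
  have "0 < (1 - a) * (1 + \<gamma>)" using \<gamma> a by simp
  then show "0 \<le> moebius_extremal_coeff \<gamma> a 0" "moebius_extremal_coeff \<gamma> a 0 < 1"
    unfolding moebius_extremal_coeff_0 using \<gamma> one_minus_pos by (auto simp: field_simps)
qed

text \<open>The factor \<open>1 - moebius_extremal_coeff \<gamma> a 0\<close>, which vanishes as \<open>a\<close> tends to 1, is split off; the
  other factor tends to \<open>2 / (1 + \<gamma>)\<close>.\<close>
lemma abs_moebius_extremal_coeff:
  assumes "1 \<le> n"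
  shows "\<bar>moebius_extremal_coeff \<gamma> a n\<bar> =
    (1 - moebius_extremal_coeff \<gamma> a 0) * ((1 + a) / (a * (1 + \<gamma>)) * (a * (1 - \<gamma>) / (1 - a * \<gamma>)) ^ n)"
proof -
  have "1 - moebius_extremal_coeff \<gamma> a 0 = (1 - a) * (1 + \<gamma>) / (1 - a * \<gamma>)"
    unfolding moebius_extremal_coeff_0 using one_minus_pos by (simp add: field_simps)
  moreover have "(1 - a) * (1 + \<gamma>) / (1 - a * \<gamma>) * ((1 + a) / (a * (1 + \<gamma>))) = (1 - a\<^sup>2) / (a * (1 - a * \<gamma>))"
    using one_minus_pos \<gamma> by (simp add: divide_simps) (simp add: algebra_simps power2_eq_square)
  ultimately have "(1 - a\<^sup>2) / (a * (1 - a * \<gamma>)) = (1 - moebius_extremal_coeff \<gamma> a 0) * ((1 + a) / (a * (1 + \<gamma>)))"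
    by simp
  moreover have "0 \<le> (1 - a\<^sup>2) / (a * (1 - a * \<gamma>)) * (a * (1 - \<gamma>) / (1 - a * \<gamma>)) ^ n"
    using one_minus_pos \<gamma> a
    by (intro mult_nonneg_nonneg zero_le_power divide_nonneg_pos) (auto simp: abs_square_le_1)
  moreover have "moebius_extremal_coeff \<gamma> a n =
      - ((1 - a\<^sup>2) / (a * (1 - a * \<gamma>)) * (a * (1 - \<gamma>) / (1 - a * \<gamma>)) ^ n)"
    using assms by (simp add: moebius_extremal_coeff_def)
  ultimately show ?thesis
    by (simp only: abs_minus_cancel abs_of_nonneg mult.assoc)
qed

lemma moebius_extremal_den:
  assumes "z \<in> Omega \<gamma>"
  shows "cmod (of_real a - (of_real \<gamma> + of_real (1 - \<gamma>) * z)) <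
    cmod (1 - of_real a * (of_real \<gamma> + of_real (1 - \<gamma>) * z))"
proof -
  define W where "W = of_real \<gamma> + of_real (1 - \<gamma>) * z"
  have "cmod W < 1" using Omega_iff[of \<gamma> z] assms \<gamma> a by (simp add: W_def)
  then have "cmod (of_real a - W) < cmod (1 - of_real a * W)"
    using cmod_real_add_less[of a "- W"] \<gamma> a by simp
  then show ?thesis by (simp add: W_def)
qed

lemma cmod_moebius_extremal_less:
  assumes "z \<in> Omega \<gamma>"
  shows "cmod (moebius_extremal \<gamma> a z) < 1"
  using moebius_extremal_den[OF assms] unfolding moebius_extremal_def norm_divide
  by (subst divide_less_eq_1_pos) (auto intro: le_less_trans[OF norm_ge_zero])

lemma moebius_extremal_has_field_derivative:
  assumes "z \<in> Omega \<gamma>"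
  obtains D where "(moebius_extremal \<gamma> a has_field_derivative D) (at z)"
proof -
  have "1 - of_real a * (of_real \<gamma> + of_real (1 - \<gamma>) * z) \<noteq> 0"
    using moebius_extremal_den[OF assms] by auto
  then have "moebius_extremal \<gamma> a field_differentiable at z"
    unfolding moebius_extremal_def by (intro derivative_intros) auto
  with that show ?thesis by (auto simp: field_differentiable_def)
qed

lemma moebius_extremal_sums:
  assumes z: "cmod z < 1"
  shows "(\<lambda>n. of_real (moebius_extremal_coeff \<gamma> a n) * z ^ n) sums moebius_extremal \<gamma> a z"
proof -
  define b where "b = a * (1 - \<gamma>) / (1 - a * \<gamma>)"
  define m where "m = (1 - a\<^sup>2) / (a * (1 - a * \<gamma>))"
  have b: "0 \<le> b" "b \<le> 1"
    using one_minus_pos \<gamma> a by (auto simp: b_def field_simps)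
  have "cmod (of_real b * z) \<le> cmod z"
    using b z mult_right_mono[of b 1 "cmod z"] unfolding norm_mult norm_of_real by simp
  with z have lt: "cmod (of_real b * z) < 1" by simp
  then have geo: "(\<lambda>n. (of_real b * z) ^ n) sums (1 / (1 - of_real b * z))"
    by (rule geometric_sums)
  have "(\<lambda>n. (if n = 0 then complex_of_real (1 / a) else 0) - of_real m * (of_real b * z) ^ n) sums
      (of_real (1 / a) - of_real m * (1 / (1 - of_real b * z)))"
    by (intro sums_diff sums_mult geo sums_single)
  moreover have "moebius_extremal_coeff \<gamma> a n = (if n = 0 then 1 / a else 0) - m * b ^ n" for n
    by (simp only: moebius_extremal_coeff_def b_def m_def)
  then have "(if n = 0 then complex_of_real (1 / a) else 0) - of_real m * (of_real b * z) ^ n =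
      of_real (moebius_extremal_coeff \<gamma> a n) * z ^ n" for n
    by (simp only:) (simp add: power_mult_distrib left_diff_distrib)
  moreover have "of_real (1 / a) - of_real m * (1 / (1 - of_real b * z)) = moebius_extremal \<gamma> a z"
  proof -
    have nz: "complex_of_real (1 - a * \<gamma>) \<noteq> 0" "complex_of_real a \<noteq> 0"
      using one_minus_pos \<gamma> unfolding of_real_eq_0_iff by auto
    have d: "1 - of_real b * z \<noteq> 0" using lt by auto
    have den: "1 - of_real a * (of_real \<gamma> + of_real (1 - \<gamma>) * z) = of_real (1 - a * \<gamma>) * (1 - of_real b * z)"
    proof -
      have "of_real (1 - a * \<gamma>) * complex_of_real b = of_real (a * (1 - \<gamma>))"
        unfolding of_real_mult[symmetric] of_real_eq_iff using one_minus_pos by (simp add: b_def)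
      then have "of_real (1 - a * \<gamma>) * (1 - of_real b * z) = of_real (1 - a * \<gamma>) - of_real (a * (1 - \<gamma>)) * z"
        by (simp only: right_diff_distrib mult.assoc[symmetric]) simp
      then show ?thesis by (simp add: algebra_simps)
    qed
    have m: "complex_of_real m = of_real (1 - a\<^sup>2) / (of_real a * of_real (1 - a * \<gamma>))"
      by (simp add: m_def)
    define W where "W = of_real \<gamma> + of_real (1 - \<gamma>) * z"
    have W: "1 - of_real a * W \<noteq> 0" unfolding W_def den using nz d by simp
    have "of_real m * (1 / (1 - of_real b * z)) = of_real (1 - a\<^sup>2) / (of_real a * (1 - of_real a * W))"
      unfolding W_def den m by (simp only: times_divide_times_eq mult_1_right mult.assoc)
    then have "of_real (1 / a) - of_real m * (1 / (1 - of_real b * z)) =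
        1 / of_real a - of_real (1 - a\<^sup>2) / (of_real a * (1 - of_real a * W))" by simp
    also have "\<dots> = (of_real a - W) / (1 - of_real a * W)"
      using nz W by (simp add: divide_simps) (simp add: algebra_simps power2_eq_square)
    finally show ?thesis by (simp add: moebius_extremal_def W_def)
  qed
  ultimately show ?thesis by simp
qed

lemma admissible_moebius_extremal:
  "admissible \<gamma> (\<lambda>z. moebius_extremal \<gamma> a z *\<^sub>C (id_blinfun :: 'h::complex_hilbert_space \<Rightarrow>\<^sub>L 'h))
    (\<lambda>n. of_real (moebius_extremal_coeff \<gamma> a n) *\<^sub>C id_blinfun)"
  unfolding admissible_def
proof (intro conjI ballI allI impI)
  let ?I = "id_blinfun :: 'h \<Rightarrow>\<^sub>L 'h"
  have scalar: "c *\<^sub>C ?I \<in> bounded_operators" for c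
    by (simp add: bounded_operators_def scaleC_blinfun.rep_eq scaleC_scaleC mult.commute)
  then show "moebius_extremal \<gamma> a z *\<^sub>C ?I \<in> bounded_operators"
    and "of_real (moebius_extremal_coeff \<gamma> a n) *\<^sub>C ?I \<in> bounded_operators" for z n by simp_all
  interpret L: bounded_linear "\<lambda>c. c *\<^sub>C ?I" by (rule bounded_linear_scaleC_left)
  show "vector_analytic_on (\<lambda>z. moebius_extremal \<gamma> a z *\<^sub>C ?I) (Omega \<gamma>)"
    unfolding vector_analytic_on_def
  proof (intro conjI ballI open_Omega)
    fix z assume "z \<in> Omega \<gamma>"
    then obtain D where "(moebius_extremal \<gamma> a has_field_derivative D) (at z)"
      by (rule moebius_extremal_has_field_derivative)
    then have "((\<lambda>w. (moebius_extremal \<gamma> a w - moebius_extremal \<gamma> a z) / (w - z)) \<longlongrightarrow> D) (at z)"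
      by (simp add: has_field_derivative_iff)
    from L.tendsto[OF this]
    show "\<exists>D. ((\<lambda>w. inverse (w - z) *\<^sub>C (moebius_extremal \<gamma> a w *\<^sub>C ?I - moebius_extremal \<gamma> a z *\<^sub>C ?I)) \<longlongrightarrow> D) (at z)"
      by (auto simp: L.diff[symmetric] scaleC_scaleC divide_inverse mult.commute)
  qed
  show "norm (moebius_extremal \<gamma> a z *\<^sub>C ?I) \<le> 1" if "z \<in> Omega \<gamma>" for z
    using mult_mono[of "cmod (moebius_extremal \<gamma> a z)" 1 "norm ?I" 1]
      cmod_moebius_extremal_less[OF that] norm_id_blinfun_le[where 'a = 'h]
    by (simp add: norm_scaleC)
  show "(\<lambda>n. z ^ n *\<^sub>C of_real (moebius_extremal_coeff \<gamma> a n) *\<^sub>C ?I) sums (moebius_extremal \<gamma> a z *\<^sub>C ?I)"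
    if "cmod z < 1" for z
    using L.sums[OF moebius_extremal_sums[OF that]] by (simp add: scaleC_scaleC mult.commute)
  show "\<exists>\<alpha>\<^sub>0. cmod \<alpha>\<^sub>0 < 1 \<and> of_real (moebius_extremal_coeff \<gamma> a 0) *\<^sub>C ?I = \<alpha>\<^sub>0 *\<^sub>C ?I"
    using moebius_extremal_coeff_0_bounds
    by (intro exI[of _ "of_real (moebius_extremal_coeff \<gamma> a 0)"]) simp
qed

end

text \<open>Let \<open>e\<close> be the zeroth coefficient.  The first \<open>N\<close> terms bound the Bohr sum below by
  \<open>e S + (1 - e) q a\<close>, where \<open>q\<close> is continuous up to \<open>a = 1\<close> and \<open>q 1\<close> tends to
  \<open>2 / (1 + \<gamma>) (1 / (1 - r) - S)\<close> as \<open>N\<close> grows.  The hypothesis says that this limit exceeds \<open>S\<close>, so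
  one first fixes \<open>N\<close> and then takes \<open>a\<close> close to 1.\<close>
lemma cesaro_bohr_sum_exceeds:
  assumes \<gamma>: "0 \<le> \<gamma>" "\<gamma> < 1" and \<alpha>: "-1 < \<alpha>" and r: "0 \<le> r" "r < 1"
    and neg: "cesaro_radius_fun \<gamma> \<alpha> r < 0"
  obtains a where "\<gamma> < a" "a < 1"
    "\<And>A :: nat \<Rightarrow> 'a::real_normed_vector. (\<And>n. norm (A n) = \<bar>moebius_extremal_coeff \<gamma> a n\<bar>) \<Longrightarrow>
      summable (cesaro_bohr_term \<alpha> A r) \<Longrightarrow>
      (\<alpha> + 1) * cesaro_series \<alpha> r < cesaro_bohr_sum \<alpha> A r"
proof -
  define S where "S = (\<alpha> + 1) * cesaro_series \<alpha> r"
  define w where "w n = 1 - (\<alpha> + 1) / (\<alpha> + real n + 1)" for n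
  have w: "(\<Sum>k=1..n. cesaro_weight \<alpha> n k) = w n" for n
    unfolding w_def by (rule sum_cesaro_weight[OF \<alpha>])
  have "(\<lambda>n. r ^ n - (\<alpha> + 1) * (r ^ n / (\<alpha> + real n + 1))) sums (1 / (1 - r) - S)"
    unfolding S_def cesaro_series_def
    using summable_cesaro_series[of \<alpha> r] \<alpha> r
    by (intro sums_diff sums_mult summable_sums geometric_sums) auto
  then have "(\<lambda>n. r ^ n * w n) sums (1 / (1 - r) - S)"
    by (simp add: w_def algebra_simps)
  then have "(\<lambda>N. 2 / (1 + \<gamma>) * (\<Sum>n<N. r ^ n * w n)) \<longlonglongrightarrow> 2 / (1 + \<gamma>) * (1 / (1 - r) - S)"
    unfolding sums_def by (intro tendsto_intros)
  moreover have "S < 2 / (1 + \<gamma>) * (1 / (1 - r) - S)"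
  proof -
    have "(3 + \<gamma>) * S < 2 * (1 / (1 - r))"
      using neg by (simp add: cesaro_radius_fun_def S_def mult_ac add.commute)
    then have "(1 + \<gamma>) * S < 2 * (1 / (1 - r) - S)" by (simp add: algebra_simps)
    then show ?thesis using \<gamma> by (simp add: pos_less_divide_eq mult.commute)
  qed
  ultimately have "eventually (\<lambda>N. S < 2 / (1 + \<gamma>) * (\<Sum>n<N. r ^ n * w n)) sequentially"
    by (rule order_tendstoD)
  then obtain N where N: "S < 2 / (1 + \<gamma>) * (\<Sum>n<N. r ^ n * w n)"
    by (auto simp: eventually_sequentially)
  define q where "q a = (\<Sum>n<N. r ^ n * (\<Sum>k=1..n. cesaro_weight \<alpha> n k *
    ((1 + a) / (a * (1 + \<gamma>)) * (a * (1 - \<gamma>) / (1 - a * \<gamma>)) ^ k)))" for a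
  have "(q \<longlongrightarrow> q 1) (at_left 1)"
    unfolding q_def using \<gamma> by (intro tendsto_intros) auto
  moreover have "q 1 = 2 / (1 + \<gamma>) * (\<Sum>n<N. r ^ n * w n)"
    using \<gamma> by (simp add: q_def w[symmetric] sum_distrib_left sum_distrib_right mult_ac)
  ultimately have "eventually (\<lambda>a. S < q a) (at_left 1)"
    using N by (intro order_tendstoD(1)) auto
  moreover have "eventually (\<lambda>a. a \<in> {\<gamma><..<1}) (at_left 1)"
    using \<gamma> by (intro eventually_at_leftI[of \<gamma>]) auto
  ultimately have "eventually (\<lambda>a. S < q a \<and> a \<in> {\<gamma><..<1}) (at_left 1)"
    by eventually_elim simp
  then obtain a where a: "S < q a" "\<gamma> < a" "a < 1"
    using eventually_happens'[of "at_left (1::real)"] by force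
  show ?thesis
  proof (rule that[OF a(2,3)])
    fix A :: "nat \<Rightarrow> 'a"
    assume A: "\<And>n. norm (A n) = \<bar>moebius_extremal_coeff \<gamma> a n\<bar>"
      and summable: "summable (cesaro_bohr_term \<alpha> A r)"
    define e where "e = moebius_extremal_coeff \<gamma> a 0"
    have e: "0 \<le> e" "e < 1"
      using moebius_extremal_coeff_0_bounds[OF \<gamma>(1) a(2,3)] by (simp_all add: e_def)
    have "norm (A 0) = e" using A[of 0] e by (simp add: e_def)
    moreover have "(\<Sum>n<N. r ^ n * (\<Sum>k=1..n. cesaro_weight \<alpha> n k * norm (A k))) = (1 - e) * q a"
    proof -
      have "(\<Sum>k=1..n. cesaro_weight \<alpha> n k * norm (A k)) =
          (\<Sum>k=1..n. (1 - e) * (cesaro_weight \<alpha> n k *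
            ((1 + a) / (a * (1 + \<gamma>)) * (a * (1 - \<gamma>) / (1 - a * \<gamma>)) ^ k)))" for n
        by (intro sum.cong refl)
          (simp add: A abs_moebius_extremal_coeff[OF \<gamma>(1) a(2,3)] e_def)
      then show ?thesis
        by (simp only: q_def sum_distrib_left[symmetric] mult.left_commute)
    qed
    ultimately have "e * S + (1 - e) * q a \<le> cesaro_bohr_sum \<alpha> A r"
      using cesaro_bohr_sum_ge[OF \<alpha> r summable, of N] by (simp add: S_def)
    moreover have "(1 - e) * S < (1 - e) * q a"
      using e a by (intro mult_strict_left_mono) auto
    moreover have "e * S + (1 - e) * S = S" by (simp add: algebra_simps)
    ultimately have "S < cesaro_bohr_sum \<alpha> A r" by linarith
    then show "(\<alpha> + 1) * cesaro_series \<alpha> r < cesaro_bohr_sum \<alpha> A r"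
      by (simp only: S_def)
  qed
qed

section \<open>The sharp Bohr radius\<close>

theorem theorem2p1:
  fixes \<gamma> \<alpha> :: real
  assumes "0 \<le> \<gamma>" and "\<gamma> < 1" and "\<alpha> > -1"
  shows "\<exists>R. smallest_root_in_unit_interval (cesaro_radius_fun \<gamma> \<alpha>) R \<and>
    (\<forall>(f :: complex \<Rightarrow> 'h::complex_hilbert_space \<Rightarrow>\<^sub>L 'h) A r.
        admissible \<gamma> f A \<and> 0 \<le> r \<and> r \<le> R \<longrightarrow>
        summable (cesaro_bohr_term \<alpha> A r) \<and>
        cesaro_bohr_sum \<alpha> A r \<le> (\<alpha> + 1) * cesaro_series \<alpha> r) \<and>
    (\<forall>r. 0 < r \<and> r \<le> R \<longrightarrow>
        (\<lambda>t. t powr \<alpha> / (1 - t)) integrable_on {0..r} \<and>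
        (\<alpha> + 1) * cesaro_series \<alpha> r =
          (\<alpha> + 1) / r powr (\<alpha> + 1) * integral {0..r} (\<lambda>t. t powr \<alpha> / (1 - t))) \<and>
    ((\<exists>x::'h. x \<noteq> 0) \<longrightarrow>
      (\<forall>R'. R < R' \<and> R' < 1 \<longrightarrow>
        (\<exists>(f :: complex \<Rightarrow> 'h \<Rightarrow>\<^sub>L 'h) A r.
            admissible \<gamma> f A \<and> 0 \<le> r \<and> r \<le> R' \<and>
            summable (cesaro_bohr_term \<alpha> A r) \<and>
            cesaro_bohr_sum \<alpha> A r > (\<alpha> + 1) * cesaro_series \<alpha> r)))"
proof -
  obtain R where R: "0 < R" "R < 1" "cesaro_radius_fun \<gamma> \<alpha> R = 0"
    and pos: "\<And>r. 0 \<le> r \<Longrightarrow> r < R \<Longrightarrow> 0 < cesaro_radius_fun \<gamma> \<alpha> r"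
    and neg: "\<And>r. R < r \<Longrightarrow> r < 1 \<Longrightarrow> cesaro_radius_fun \<gamma> \<alpha> r < 0"
    using ex_cesaro_radius[OF assms(1,3)] by metis
  have "R \<le> s" if "0 < s" "cesaro_radius_fun \<gamma> \<alpha> s = 0" for s
    using pos[of s] that by (cases "s < R") auto
  with R have root: "smallest_root_in_unit_interval (cesaro_radius_fun \<gamma> \<alpha>) R"
    by (simp add: smallest_root_in_unit_interval_def)
  have nonneg: "0 \<le> cesaro_radius_fun \<gamma> \<alpha> r" if "0 \<le> r" "r \<le> R" for r
    using pos[of r] R that by (cases "r = R") auto
  show ?thesis
  proof (intro exI[of _ R] conjI allI impI root)
    fix f :: "complex \<Rightarrow> 'h \<Rightarrow>\<^sub>L 'h" and A r
    assume *: "admissible \<gamma> f A \<and> 0 \<le> r \<and> r \<le> R"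
    then show "summable (cesaro_bohr_term \<alpha> A r)"
      and "cesaro_bohr_sum \<alpha> A r \<le> (\<alpha> + 1) * cesaro_series \<alpha> r"
      using cesaro_bohr_inequality[OF assms(1,2,3), of f A r] nonneg[of r] R by auto
  next
    fix r assume "0 < r \<and> r \<le> R"
    then have r: "0 < r" "r < 1" using R by auto
    note int = has_integral_powr_over_one_minus[OF assms(3) r]
    show "(\<lambda>t. t powr \<alpha> / (1 - t)) integrable_on {0..r}"
      using int by blast
    show "(\<alpha> + 1) * cesaro_series \<alpha> r =
        (\<alpha> + 1) / r powr (\<alpha> + 1) * integral {0..r} (\<lambda>t. t powr \<alpha> / (1 - t))"
      using integral_unique[OF int] r by simp
  next
    fix R' assume ex: "\<exists>x::'h. x \<noteq> 0" and "R < R' \<and> R' < 1"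
    then have R': "R < R'" "0 \<le> R'" "R' < 1" using R by auto
    obtain x :: 'h where x: "x \<noteq> 0" using ex by blast
    have "norm (id_blinfun :: 'h \<Rightarrow>\<^sub>L 'h) = 1"
      using norm_blinfun[of "id_blinfun :: 'h \<Rightarrow>\<^sub>L 'h" x] x norm_id_blinfun_le[where 'a = 'h] by simp
    then have norm: "norm (of_real t *\<^sub>C id_blinfun :: 'h \<Rightarrow>\<^sub>L 'h) = \<bar>t\<bar>" for t
      by (simp add: norm_scaleC)
    obtain a where a: "\<gamma> < a" "a < 1"
      and exceeds: "\<And>A :: nat \<Rightarrow> 'h \<Rightarrow>\<^sub>L 'h. (\<And>n. norm (A n) = \<bar>moebius_extremal_coeff \<gamma> a n\<bar>) \<Longrightarrow>
        summable (cesaro_bohr_term \<alpha> A R') \<Longrightarrow>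
        (\<alpha> + 1) * cesaro_series \<alpha> R' < cesaro_bohr_sum \<alpha> A R'"
      using cesaro_bohr_sum_exceeds[OF assms R'(2,3) neg[OF R'(1,3)]] by metis
    define A where "A n = of_real (moebius_extremal_coeff \<gamma> a n) *\<^sub>C (id_blinfun :: 'h \<Rightarrow>\<^sub>L 'h)" for n
    have adm: "admissible \<gamma> (\<lambda>z. moebius_extremal \<gamma> a z *\<^sub>C id_blinfun) A"
      unfolding A_def using admissible_moebius_extremal[OF assms(1) a] .
    obtain \<alpha>\<^sub>0 where \<alpha>\<^sub>0: "A 0 = \<alpha>\<^sub>0 *\<^sub>C id_blinfun" "cmod \<alpha>\<^sub>0 < 1"
      using adm by (auto simp: admissible_def)
    have summable: "summable (cesaro_bohr_term \<alpha> A R')"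
      using R' admissible_coeff_bound[OF assms(1,2) adm \<alpha>\<^sub>0]
      by (intro cesaro_bohr_sum_le(1)[OF assms(3)])
    then show "\<exists>(f :: complex \<Rightarrow> 'h \<Rightarrow>\<^sub>L 'h) A r.
        admissible \<gamma> f A \<and> 0 \<le> r \<and> r \<le> R' \<and>
        summable (cesaro_bohr_term \<alpha> A r) \<and>
        cesaro_bohr_sum \<alpha> A r > (\<alpha> + 1) * cesaro_series \<alpha> r"
      using adm R' exceeds[of A] norm by (auto simp: A_def)
  qed
qed

end
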